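(* QR with local maximum volume pivoting is a rank-revealer with $\mu_{m,n,k}=\sqrt{1+5kn}$ and computes a partial QR factorization satisfying an interpolative bound with $\nu\le1$. Explicitly: let $m,n\ge1$, $1\le k\le\min(m,n)$, $A\in\mathbb{R}^{m\times n}$, and let $P$ be a permutation matrix such that the first $k$ columns of $AP$ form an $m\times k$ local maximum volume submatrix of $A$. Let $$AP=\begin{bmatrix}Q_1&Q_2\end{bmatrix}\begin{bmatrix}R_{11}&R_{12}\\0&R_{22}\end{bmatrix}$$ be a partial QR factorization and let $A_k=Q_1\begin{bmatrix}R_{11}&R_{12}\end{bmatrix}P^{-1}$. Then $\operatorname{rank}(A_k)\le k$ and, with $\mu=\sqrt{1+5kn}$, $$\frac1\mu\,\sigma_j(A)\le\sigma_j(A_k)\le\mu\,\sigma_j(A),\qquad 1\le j\le k,$$ $$\frac1\mu\,\sigma_{k+j}(A)\le\sigma_j(A-A_k)\le\mu\,\sigma_{k+j}(A),\qquad 1\le j\le\min(m,n)-k,$$ and moreover $\|R_{11}^{-1}R_{12}\|_{\max}\le1$.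
   Context: $\sigma_1(M)\ge\sigma_2(M)\ge\cdots\ge 0$ denote the singular values of a real matrix $M$, and $\|M\|_{\max}$ is the maximum absolute value of its entries (equal to $0$ for an empty matrix). The volume of $M\in\mathbb{R}^{p\times q}$ is $\mathrm{vol}(M)=\prod_{j=1}^{\min(p,q)}\sigma_j(M)$. A $p\times q$ submatrix of $A$ is specified by a set of $p$ row indices and a set of $q$ column indices. A $p\times q$ submatrix $B$ of $A$ is a local maximum volume submatrix if $\mathrm{vol}(B)>0$ and $\mathrm{vol}(B)\ge\mathrm{vol}(\hat B)$ for all $p\times q$ submatrices $\hat B$ of $A$ that differ from $B$ in at most one row and at most one column. For an $m\times k$ submatrix of an $m\times n$ matrix all rows are used, so only replacing a single column is relevant. In a partial QR factorization, $Q_1\in\mathbb{R}^{m\times k}$, $Q_2\in\mathbb{R}^{m\times(\min(m,n)-k)}$, $[Q_1\ Q_2]$ has orthonormal columns, $R_{11}\in\mathbb{R}^{k\times k}$ is upper triangular, $R_{12}\in\mathbb{R}^{k\times(n-k)}$ and $R_{22}\in\mathbb{R}^{(\min(m,n)-k)\times(n-k)}$ ($R_{22}$ need not be triangular). QR with local maximum volume pivoting selects $P$ so that the first $k$ columns of $AP$ are a local maximum volume $m\times k$ submatrix. An algorithm is a rank-revealer with factor $\mu_{m,n,k}\ge1$ (bounded by a polynomial in $m,n,k$ and not depending on $A$) if it computes a matrix $A_k$ of rank at most $k$ satisfying the two displayed families of singular value inequalities. The partial QR factorization satisfies an interpolative bound with $\nu\ge0$ if $\|R_{11}^{-1}R_{12}\|_{\max}\le\nu$.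 *)

theory Defs
  imports
    Complex_Main
    "HOL-Combinatorics.Permutations"
    "Jordan_Normal_Form.Char_Poly"
    "Jordan_Normal_Form.Gauss_Jordan_Elimination"
    "Jordan_Normal_Form.DL_Rank"
    "Jordan_Normal_Form.DL_Submatrix"
begin

text \<open>The eigenvalues of \<open>M\<^sup>T M\<close> are counted with algebraic multiplicity and put in
  non-increasing order.  There are \<open>dim_col M\<close> of them (the matrix is symmetric positive
  semidefinite, so \<open>proots\<close> misses no complex root); only the largest \<open>min p q\<close> of them
  belong to the singular values of a \<open>p \<times> q\<close> matrix.\<close>

definition singular_values :: "real mat \<Rightarrow> real list" where
  "singular_values M =
     take (min (dim_row M) (dim_col M))
       (map sqrt (rev (sorted_list_of_multiset (proots (char_poly (transpose_mat M * M))))))"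

text \<open>The index is 1-based; values outside \<open>{1..min (dim_row M) (dim_col M)}\<close> are meaningless.\<close>

definition sing_val :: "nat \<Rightarrow> real mat \<Rightarrow> real" where
  "sing_val j M = singular_values M ! (j - 1)"

definition volume :: "real mat \<Rightarrow> real" where
  "volume M = (\<Prod>j = 1..min (dim_row M) (dim_col M). sing_val j M)"

definition max_norm :: "real mat \<Rightarrow> real" where
  "max_norm M = Max (insert 0 (abs ` elements_mat M))"

text \<open>The submatrix with rows \<open>I\<close> and columns \<open>J\<close>.  The competitors have the same shape, and
  differ from it in at most one row index and at most one column index.\<close>

definition local_max_volume :: "real mat \<Rightarrow> nat set \<Rightarrow> nat set \<Rightarrow> bool" where
  "local_max_volume A I J \<longleftrightarrow>
     I \<subseteq> {0..<dim_row A} \<and> J \<subseteq> {0..<dim_col A} \<and>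
     volume (submatrix A I J) > 0 \<and>
     (\<forall>I' J'. I' \<subseteq> {0..<dim_row A} \<longrightarrow> J' \<subseteq> {0..<dim_col A} \<longrightarrow>
        card I' = card I \<longrightarrow> card J' = card J \<longrightarrow>
        card (I - I') \<le> 1 \<longrightarrow> card (J - J') \<le> 1 \<longrightarrow>
        volume (submatrix A I' J') \<le> volume (submatrix A I J))"

text \<open>Column \<open>j\<close> of \<open>A * permutation_matrix n p\<close> is column \<open>p j\<close> of \<open>A\<close>.\<close>

definition permutation_matrix :: "nat \<Rightarrow> (nat \<Rightarrow> nat) \<Rightarrow> real mat" where
  "permutation_matrix n p = mat n n (\<lambda>(i, j). if i = p j then 1 else 0)"

text \<open>Meaningful for invertible matrices only.\<close>

definition mat_inv :: "real mat \<Rightarrow> real mat" where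
  "mat_inv M = the (mat_inverse M)"

text \<open>The block row \<open>[A B]\<close>, for \<open>A\<close> and \<open>B\<close> with equally many rows.\<close>

definition block_row :: "real mat \<Rightarrow> real mat \<Rightarrow> real mat" where
  "block_row A B = four_block_mat A B (0\<^sub>m 0 (dim_col A)) (0\<^sub>m 0 (dim_col B))"

text \<open>A partial QR factorization of the \<open>m \<times> n\<close> matrix \<open>M\<close> (below, \<open>M = A * P\<close>).\<close>

definition partial_qr ::
  "nat \<Rightarrow> nat \<Rightarrow> nat \<Rightarrow> real mat \<Rightarrow> real mat \<Rightarrow> real mat \<Rightarrow> real mat \<Rightarrow> real mat \<Rightarrow> real mat \<Rightarrow> bool"
where
  "partial_qr m n k M Q1 Q2 R11 R12 R22 \<longleftrightarrow>
     Q1 \<in> carrier_mat m k \<and> Q2 \<in> carrier_mat m (min m n - k) \<and>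
     R11 \<in> carrier_mat k k \<and> R12 \<in> carrier_mat k (n - k) \<and>
     R22 \<in> carrier_mat (min m n - k) (n - k) \<and>
     transpose_mat (block_row Q1 Q2) * block_row Q1 Q2 = 1\<^sub>m (min m n) \<and>
     upper_triangular R11 \<and>
     M = block_row Q1 Q2 * four_block_mat R11 R12 (0\<^sub>m (min m n - k) k) R22"

text \<open>The condition on a rank-revealing factor: it is at least 1 and bounded by a polynomial
  in \<open>m\<close>, \<open>n\<close>, \<open>k\<close> (with coefficients \<open>c a b e\<close>, of degree at most \<open>d\<close> in each variable).\<close>

definition rank_revealing_factor :: "(nat \<Rightarrow> nat \<Rightarrow> nat \<Rightarrow> real) \<Rightarrow> bool" where
  "rank_revealing_factor \<mu> \<longleftrightarrow>
     (\<forall>m n k. 1 \<le> k \<and> k \<le> min m n \<longrightarrow> 1 \<le> \<mu> m n k) \<and>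
     (\<exists>(d::nat) (c :: nat \<Rightarrow> nat \<Rightarrow> nat \<Rightarrow> real).
        \<forall>m n k. 1 \<le> k \<and> k \<le> min m n \<longrightarrow>
          \<mu> m n k \<le> (\<Sum>a\<le>d. \<Sum>b\<le>d. \<Sum>e\<le>d. c a b e * real m ^ a * real n ^ b * real k ^ e))"

text \<open>\<open>A\<^sub>k\<close> has rank at most \<open>k\<close> and satisfies the two families of singular value
  inequalities with factor \<open>\<mu>\<close>, for an \<open>m \<times> n\<close> matrix \<open>A\<close>.\<close>

definition rank_reveals :: "nat \<Rightarrow> nat \<Rightarrow> nat \<Rightarrow> real \<Rightarrow> real mat \<Rightarrow> real mat \<Rightarrow> bool" where
  "rank_reveals m n k \<mu> A Ak \<longleftrightarrow>
     vec_space.rank m Ak \<le> k \<and>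
     (\<forall>j\<in>{1..k}. 1 / \<mu> * sing_val j A \<le> sing_val j Ak \<and> sing_val j Ak \<le> \<mu> * sing_val j A) \<and>
     (\<forall>j\<in>{1..min m n - k}.
        1 / \<mu> * sing_val (k + j) A \<le> sing_val j (A - Ak) \<and>
        sing_val j (A - Ak) \<le> \<mu> * sing_val (k + j) A)"

end

theory Submission
  imports Defs
begin

text \<open>
  Write \<open>A P = Q R\<close> with \<open>R = [R11 R12; 0 R22]\<close>, where \<open>Q = [Q1 Q2]\<close> has orthonormal columns, and
  \<open>n = k + l\<close>.  Singular values ignore \<open>Q\<close> and \<open>P\<close>, so \<open>A\<close>, \<open>A\<^sub>k\<close> and \<open>A - A\<^sub>k\<close> have those of \<open>R\<close>, of
  \<open>[R11 R12; 0 0]\<close> and of \<open>[0 0; 0 R22]\<close>, and everything happens inside the triangular factor.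

  Local maximality bounds the effect of every column exchange.  The squared volume of \<open>k\<close> columns is their Gram determinant
  (\<open>volume_column_selection\<close>).  Put \<open>V = R11\<inverse>\<close> and \<open>W = V R12\<close>.  Replacing the \<open>i\<close>-th pivot
  column by the \<open>j\<close>-th remaining one multiplies the Gram determinant by
  \<open>W\<^sub>i\<^sub>j\<^sup>2 + \<parallel>column j of R22\<parallel>\<^sup>2 \<parallel>row i of V\<parallel>\<^sup>2\<close> (\<open>det_gram_exchange_column\<close>), so each of
  these numbers is at most 1 (\<open>local_max_volume_qr\<close>).  The first summand gives the interpolative bound.
  Adding up all \<open>k l\<close> of them gives \<open>\<parallel>V\<parallel>\<^sup>2 \<parallel>R22\<parallel>\<^sup>2 + \<parallel>W\<parallel>\<^sup>2 \<le> K\<close> in Frobenius norms,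
  with \<open>K = k l\<close>.

  Singular values are compared by means of the
  Courant-Fischer principle: \<open>\<sigma>\<^sub>j(M)\<close> is the least \<open>c\<close> such that \<open>\<parallel>M x\<parallel> \<le> c \<parallel>x\<parallel>\<close> on the common kernel
  of some \<open>j - 1\<close> linear functionals, and there is a \<open>j\<close>-dimensional space on which
  \<open>\<parallel>M x\<parallel> \<ge> \<sigma>\<^sub>j(M) \<parallel>x\<parallel>\<close> (\<open>sing_val_small_subspace\<close>, \<open>sing_val_le\<close>, \<open>sing_val_large_subspace\<close>).  It
  follows from an orthogonal diagonalization of \<open>M\<^sup>T M\<close>.  Two of the four inequalities hold
  with factor 1, because \<open>[R11 R12; 0 0]\<close> is a projection of \<open>R\<close> and because subtracting a matrix of
  rank \<open>k\<close> shifts the index by at most \<open>k\<close>.  The other two compare \<open>R22\<close> with \<open>R11\<close>: all singular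
  values of \<open>R11\<close> are at least \<open>1 / \<parallel>V\<parallel>\<close>, while \<open>\<parallel>R22\<parallel> \<le> \<surd>K / \<parallel>V\<parallel>\<close>
  (\<open>sing_val_top_ge\<close>, \<open>sing_val_rest_le\<close>).  They hold with the factor \<open>\<surd>(1 + 2 K)\<close>, and
  \<open>2 k l \<le> 5 k n\<close>.
\<close>

section \<open>Euclidean vectors and orthogonal matrices\<close>

lemma scalar_prod_self_nonneg: "0 \<le> (v :: real vec) \<bullet> v"
  unfolding scalar_prod_def by (intro sum_nonneg) auto

lemma scalar_prod_self_eq_0:
  assumes "(v :: real vec) \<in> carrier_vec n" "v \<bullet> v = 0" shows "v = 0\<^sub>v n"
proof (rule eq_vecI)
  fix i assume "i < dim_vec (0\<^sub>v n)"
  with assms have i: "i < dim_vec v" "v $ i = 0"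
    by (auto simp: scalar_prod_def sum_nonneg_eq_0_iff)
  then show "v $ i = 0\<^sub>v n $ i" using assms by auto
qed (use assms in auto)

lemma scalar_prod_cauchy_schwarz:
  fixes v w :: "real vec"
  assumes "v \<in> carrier_vec n" "w \<in> carrier_vec n"
  shows "(v \<bullet> w)\<^sup>2 \<le> (v \<bullet> v) * (w \<bullet> w)"
proof -
  let ?I = "{0..<n}"
  have "2 * (v \<bullet> w)\<^sup>2 = (\<Sum>i\<in>?I. \<Sum>j\<in>?I. 2 * ((v $ i * w $ i) * (v $ j * w $ j)))"
    using assms by (simp only: scalar_prod_def power2_eq_square sum_product sum_distrib_left[of 2, symmetric])
      (simp add: carrier_vecD)
  also have "\<dots> \<le> (\<Sum>i\<in>?I. \<Sum>j\<in>?I. (v $ i * v $ i) * (w $ j * w $ j) + (v $ j * v $ j) * (w $ i * w $ i))"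
  proof (intro sum_mono)
    fix i j
    have "0 \<le> (v $ i * w $ j - v $ j * w $ i)\<^sup>2" by simp
    then show "2 * ((v $ i * w $ i) * (v $ j * w $ j))
        \<le> (v $ i * v $ i) * (w $ j * w $ j) + (v $ j * v $ j) * (w $ i * w $ i)"
      by (simp add: power2_eq_square algebra_simps)
  qed
  also have "\<dots> = (v \<bullet> v) * (w \<bullet> w) + (\<Sum>i\<in>?I. \<Sum>j\<in>?I. (v $ j * v $ j) * (w $ i * w $ i))"
    using assms by (simp add: sum.distrib scalar_prod_def sum_product)
  also have "(\<Sum>i\<in>?I. \<Sum>j\<in>?I. (v $ j * v $ j) * (w $ i * w $ i)) = (v \<bullet> v) * (w \<bullet> w)"
    by (subst sum.swap) (use assms in \<open>simp add: scalar_prod_def sum_product\<close>)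
  finally show ?thesis by simp
qed

lemma scalar_prod_mult_mat_vec:
  assumes "(M :: real mat) \<in> carrier_mat p q" "v \<in> carrier_vec q" "w \<in> carrier_vec p"
  shows "(M *\<^sub>v v) \<bullet> w = v \<bullet> (M\<^sup>T *\<^sub>v w)"
proof -
  have "w \<bullet> (M *\<^sub>v v) = (M\<^sup>T *\<^sub>v w) \<bullet> v"
    using assms transpose_vec_mult_scalar[of M p q v w] by simp
  then show ?thesis using assms comm_scalar_prod by (metis mult_mat_vec_carrier transpose_carrier_mat)
qed

lemma scalar_prod_mult_mat_vec2:
  assumes "(M :: real mat) \<in> carrier_mat p q" "v \<in> carrier_vec q" "w \<in> carrier_vec q"
  shows "(M *\<^sub>v v) \<bullet> (M *\<^sub>v w) = v \<bullet> ((M\<^sup>T * M) *\<^sub>v w)"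
  using assms by (subst scalar_prod_mult_mat_vec[of M p q]) auto

lemma scalar_prod_isometry:
  assumes "(Q :: real mat) \<in> carrier_mat p q" "Q\<^sup>T * Q = 1\<^sub>m q" "v \<in> carrier_vec q"
  shows "(Q *\<^sub>v v) \<bullet> (Q *\<^sub>v v) = v \<bullet> v"
  using assms by (simp add: scalar_prod_mult_mat_vec2[of Q p q])

text \<open>The matrix is the Householder reflection in the hyperplane orthogonal to \<open>u - e\<close>, where \<open>e\<close> is
  the first unit vector; it exchanges \<open>e\<close> and \<open>u\<close>.  In the diagonalization below, it
  moves an eigenvector to the first coordinate.\<close>

lemma orthogonal_with_first_column:
  assumes u: "(u :: real vec) \<in> carrier_vec (Suc n)" and uu: "u \<bullet> u = 1"
  obtains H where "H \<in> carrier_mat (Suc n) (Suc n)" "H\<^sup>T * H = 1\<^sub>m (Suc n)" "col H 0 = u"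
proof (cases "u = unit_vec (Suc n) 0")
  case True
  then show ?thesis by (intro that[of "1\<^sub>m (Suc n)"]) auto
next
  case False
  define e where "e = (unit_vec (Suc n) 0 :: real vec)"
  define w where "w = u - e"
  have e: "e \<in> carrier_vec (Suc n)" by (simp add: e_def)
  have w: "w \<in> carrier_vec (Suc n)" using u e by (simp add: w_def)
  have "w \<bullet> w \<noteq> 0"
  proof
    assume "w \<bullet> w = 0"
    then have "w = 0\<^sub>v (Suc n)" using w scalar_prod_self_eq_0 by blast
    have "u = e"
    proof (rule eq_vecI)
      fix i assume "i < dim_vec e"
      then show "u $ i = e $ i" using \<open>w = 0\<^sub>v (Suc n)\<close> u e
        by (metis (no_types) carrier_vecD eq_iff_diff_eq_0 index_minus_vec(1) index_zero_vec(1) w_def)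
    qed (use u e in auto)
    with False show False by (simp add: e_def)
  qed
  define c where "c = 2 / (w \<bullet> w)"
  have c: "c * (w \<bullet> w) = 2" using \<open>w \<bullet> w \<noteq> 0\<close> by (simp add: c_def)
  define H where "H = mat (Suc n) (Suc n) (\<lambda>(i,j). (if i = j then 1 else 0) - c * w $ i * w $ j)"
  have H: "H \<in> carrier_mat (Suc n) (Suc n)" by (simp add: H_def)
  have sym: "H\<^sup>T = H" by (rule eq_matI) (auto simp: H_def)
  have HH: "H\<^sup>T * H = 1\<^sub>m (Suc n)"
  proof (rule eq_matI)
    fix i j assume "i < dim_row (1\<^sub>m (Suc n))" "j < dim_col (1\<^sub>m (Suc n))"
    then have ij: "i < Suc n" "j < Suc n" by auto
    have "(H\<^sup>T * H) $$ (i,j) = (\<Sum>l\<in>{0..<Suc n}. ((if i = l then 1 else 0) - c * w $ i * w $ l) * ((if l = j then 1 else 0) - c * w $ l * w $ j))"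
      unfolding sym using ij H by (simp add: scalar_prod_def, simp add: H_def)
    also have "\<dots> = (\<Sum>l\<in>{0..<Suc n}. (if i = l then (if i = j then 1 else 0) else 0)
        - (if i = l then c * w $ i * w $ j else 0) - (if l = j then c * w $ i * w $ j else 0)
        + c * w $ i * w $ j * c * (w $ l * w $ l))"
      by (intro sum.cong) (auto simp: algebra_simps)
    also have "\<dots> = (if i = j then 1 else 0) - 2 * (c * w $ i * w $ j) + c * w $ i * w $ j * (c * (w \<bullet> w))"
      using ij w by (simp add: sum.distrib sum_subtractf sum_distrib_left[symmetric] scalar_prod_def del: sum.op_ivl_Suc)
    also have "\<dots> = 1\<^sub>m (Suc n) $$ (i,j)" using ij by (simp add: c)
    finally show "(H\<^sup>T * H) $$ (i,j) = 1\<^sub>m (Suc n) $$ (i,j)" .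
  qed (use H in auto)
  have "col H 0 = u"
  proof (rule eq_vecI)
    fix i assume "i < dim_vec u"
    then have i: "i < Suc n" using u by auto
    have w0: "w $ 0 = u $ 0 - 1" using u by (simp add: w_def e_def)
    have ue: "u \<bullet> e = u $ 0" "e \<bullet> u = u $ 0" "e \<bullet> e = 1" using u by (auto simp: e_def)
    have "w \<bullet> w = 2 * (1 - u $ 0)" using u e unfolding w_def
      by (simp add: minus_scalar_prod_distrib[of _ "Suc n"] scalar_prod_minus_distrib[of _ "Suc n"] ue uu)
    then have "c * (2 * (1 - u $ 0)) = 2" using c by simp
    then have "c * w $ 0 = -1" unfolding w0 by (simp add: algebra_simps)
    moreover have "col H 0 $ i = e $ i - (c * w $ 0) * w $ i"
      using i H by (simp add: H_def e_def)
    ultimately have "col H 0 $ i = e $ i + w $ i" by simp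
    then show "col H 0 $ i = u $ i" using u i e by (simp add: w_def)
  qed (use H u in auto)
  with H HH show ?thesis by (rule that)
qed

section \<open>Orthogonal diagonalization of symmetric matrices\<close>

lemma char_poly_linear_factors_length:
  assumes "(S :: real mat) \<in> carrier_mat n n" "char_poly S = (\<Prod>e\<leftarrow>es. [:-e, 1:])"
  shows "length es = n"
  using degree_monic_char_poly[OF assms(1)] degree_linear_factors[of uminus es] assms(2) by simp

lemma unit_eigenvector:
  assumes S: "(S :: real mat) \<in> carrier_mat n n" and e: "eigenvalue S e"
  obtains u where "u \<in> carrier_vec n" "u \<bullet> u = 1" "S *\<^sub>v u = e \<cdot>\<^sub>v u"
proof -
  from e S obtain v where v: "v \<in> carrier_vec n" "v \<noteq> 0\<^sub>v n" "S *\<^sub>v v = e \<cdot>\<^sub>v v"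
    by (auto simp: eigenvalue_def eigenvector_def)
  have pos: "v \<bullet> v > 0"
    using scalar_prod_self_nonneg[of v] scalar_prod_self_eq_0[OF v(1)] v(2) by fastforce
  define c where "c = 1 / sqrt (v \<bullet> v)"
  have "c * c * (v \<bullet> v) = 1" using pos by (simp add: c_def)
  then have 1: "(c \<cdot>\<^sub>v v) \<bullet> (c \<cdot>\<^sub>v v) = 1" using v(1) by simp
  have 2: "S *\<^sub>v (c \<cdot>\<^sub>v v) = e \<cdot>\<^sub>v (c \<cdot>\<^sub>v v)"
  proof -
    have "S *\<^sub>v (c \<cdot>\<^sub>v v) = c \<cdot>\<^sub>v (e \<cdot>\<^sub>v v)" using mult_mat_vec[OF S v(1)] v(3) by metis
    then show ?thesis by (metis mult.commute smult_smult_assoc)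
  qed
  show ?thesis by (rule that[OF _ 1 2]) (use v(1) in simp)
qed

text \<open>The list of eigenvalues is given in advance, in any order, and the diagonal follows that order; a sorted
  list therefore yields a sorted diagonal.  Each step conjugates a unit eigenvector for the head of the list
  into the first coordinate.  By symmetry the first row and column then split off, and the characteristic polynomial of
  the remaining block is the product over the tail.\<close>

lemma symmetric_diagonalization:
  fixes S :: "real mat"
  assumes "S \<in> carrier_mat n n" "S\<^sup>T = S" "char_poly S = (\<Prod>e\<leftarrow>es. [:-e, 1:])"
  shows "\<exists>U. U \<in> carrier_mat n n \<and> U\<^sup>T * U = 1\<^sub>m n \<and> S * U = U * mat_diag n (\<lambda>i. es ! i)"
  using assms
proof (induction es arbitrary: n S)
  case Nil
  then have "n = 0" using char_poly_linear_factors_length[OF Nil(1,3)] by simp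
  with Nil(1) show ?case by (intro exI[of _ "1\<^sub>m n"] conjI eq_matI) (auto simp: mat_diag_def)
next
  case (Cons e es)
  obtain m where n: "n = Suc m" using char_poly_linear_factors_length[OF Cons.prems(1,3)] by auto
  note S = Cons.prems(1)[unfolded n]
  have "poly (char_poly S) e = 0" by (simp add: Cons.prems(3))
  then have "eigenvalue S e" using eigenvalue_root_char_poly[OF S] by simp
  then obtain u where u: "u \<in> carrier_vec (Suc m)" "u \<bullet> u = 1" "S *\<^sub>v u = e \<cdot>\<^sub>v u"
    using unit_eigenvector[OF S] by metis
  obtain H where H: "H \<in> carrier_mat (Suc m) (Suc m)" and HH: "H\<^sup>T * H = 1\<^sub>m (Suc m)" and Hu: "col H 0 = u"
    using orthogonal_with_first_column[OF u(1,2)] by metis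
  have HH': "H * H\<^sup>T = 1\<^sub>m (Suc m)" using mat_mult_left_right_inverse[OF _ H HH] H by simp
  define T where "T = H\<^sup>T * (S * H)"
  have T: "T \<in> carrier_mat (Suc m) (Suc m)" using H S by (simp add: T_def)
  have Tsym: "T\<^sup>T = T"
    using H S Cons.prems(2) unfolding T_def
    by (simp add: transpose_mult[of _ "Suc m" "Suc m" _ "Suc m"] assoc_mult_mat[of _ "Suc m" "Suc m" _ "Suc m" _ "Suc m"])
  have T0: "T $$ (i, 0) = (if i = 0 then e else 0)" if i: "i < Suc m" for i
  proof -
    have "T $$ (i, 0) = row (H\<^sup>T) i \<bullet> col (S * H) 0" using i H S by (simp add: T_def)
    also have "col (S * H) 0 = e \<cdot>\<^sub>v col H 0" by (simp only: col_mult2[OF S H zero_less_Suc] Hu u(3))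
    also have "row (H\<^sup>T) i \<bullet> (e \<cdot>\<^sub>v col H 0) = e * (H\<^sup>T * H) $$ (i, 0)" using i H by simp
    finally show ?thesis using i by (simp add: HH)
  qed
  have T0': "T $$ (0, j) = (if j = 0 then e else 0)" if j: "j < Suc m" for j
  proof -
    have "T $$ (0, j) = T\<^sup>T $$ (j, 0)" using T j by simp
    then show ?thesis using T0[OF j] Tsym by simp
  qed
  \<comment> \<open>\<open>S'\<close> is what remains of \<open>T\<close> once the eigenvalue \<open>e\<close> is split off.\<close>
  define S' where "S' = mat m m (\<lambda>(i,j). T $$ (Suc i, Suc j))"
  have S': "S' \<in> carrier_mat m m" by (simp add: S'_def)
  let ?E = "mat 1 1 (\<lambda>_. e)"
  have Tblock: "T = four_block_mat ?E (0\<^sub>m 1 m) (0\<^sub>m m 1) S'"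
    by (rule eq_matI) (use T in \<open>auto simp: T0 T0' S'_def\<close>)
  have "S'\<^sup>T = S'"
  proof (rule eq_matI)
    fix i j assume "i < dim_row S'" "j < dim_col S'"
    then have ij: "i < m" "j < m" by (auto simp: S'_def)
    have "T $$ (Suc j, Suc i) = T\<^sup>T $$ (Suc i, Suc j)" using T ij by simp
    then show "S'\<^sup>T $$ (i,j) = S' $$ (i,j)" using ij Tsym by (simp add: S'_def)
  qed (auto simp: S'_def)
  have "similar_mat S T"
  proof (rule similar_matI)
    have "H * T * H\<^sup>T = (H * H\<^sup>T) * (S * (H * H\<^sup>T))"
      using H S unfolding T_def by (simp add: assoc_mult_mat[of _ "Suc m" "Suc m" _ "Suc m" _ "Suc m"])
    then show "S = H * T * H\<^sup>T" using H S by (simp add: HH')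
  qed (use H S T HH HH' in auto)
  then have "char_poly S = char_poly T" by (rule char_poly_similar)
  also have "\<dots> = char_poly ?E * char_poly S'"
    unfolding Tblock by (rule char_poly_four_block_zeros_col) (auto simp: S')
  also have "char_poly ?E = [:-e, 1:]"
    by (simp add: char_poly_defs det_single[of _] )
  finally have "[:-e, 1:] * char_poly S' = [:-e, 1:] * (\<Prod>e\<leftarrow>es. [:-e, 1:])"
    by (simp only: Cons.prems(3) list.map prod_list.Cons)
  then have "char_poly S' = (\<Prod>e\<leftarrow>es. [:-e, 1:])"
    by (metis mult_left_cancel pCons_eq_0_iff one_neq_zero)
  from Cons.IH[OF S' \<open>S'\<^sup>T = S'\<close> this] obtain V where
    V: "V \<in> carrier_mat m m" "V\<^sup>T * V = 1\<^sub>m m" "S' * V = V * mat_diag m (\<lambda>i. es ! i)" by blast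
  define F where "F = four_block_mat (1\<^sub>m 1) (0\<^sub>m 1 m) (0\<^sub>m m 1) V"
  have F: "F \<in> carrier_mat (Suc m) (Suc m)" by (rule carrier_matI) (use V in \<open>auto simp: F_def\<close>)
  have FF: "F\<^sup>T * F = 1\<^sub>m (Suc m)"
  proof -
    have "F\<^sup>T = four_block_mat (1\<^sub>m 1) (0\<^sub>m 1 m) (0\<^sub>m m 1) V\<^sup>T"
      unfolding F_def using V by (subst transpose_four_block_mat[of _ 1 1 _ m _ m]) auto
    then have "F\<^sup>T * F = four_block_mat (1\<^sub>m 1) (0\<^sub>m 1 m) (0\<^sub>m m 1) (1\<^sub>m m)"
      unfolding F_def using V by (simp add: mult_four_block_mat[of _ 1 1 _ m _ m _ _ 1 _ m] del: One_nat_def)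
    then show ?thesis using four_block_one_mat[of 1 m] by simp
  qed
  have D: "mat_diag (Suc m) (\<lambda>i. (e # es) ! i) = four_block_mat ?E (0\<^sub>m 1 m) (0\<^sub>m m 1) (mat_diag m (\<lambda>i. es ! i))"
    by (rule eq_matI) (auto simp: mat_diag_def)
  have TF: "T * F = F * mat_diag (Suc m) (\<lambda>i. (e # es) ! i)"
  proof -
    have "T * F = four_block_mat ?E (0\<^sub>m 1 m) (0\<^sub>m m 1) (S' * V)"
      unfolding Tblock F_def using V S' by (simp add: mult_four_block_mat[of _ 1 1 _ m _ m _ _ 1 _ m] del: One_nat_def)
    moreover have "F * mat_diag (Suc m) (\<lambda>i. (e # es) ! i)
        = four_block_mat ?E (0\<^sub>m 1 m) (0\<^sub>m m 1) (V * mat_diag m (\<lambda>i. es ! i))"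
      unfolding D F_def using V mat_diag_dim[of m "\<lambda>i. es ! i"]
      by (simp add: mult_four_block_mat[of _ 1 1 _ m _ m _ _ 1 _ m] left_mult_zero_mat[OF mat_diag_dim] del: One_nat_def)
    ultimately show ?thesis using V(3) by simp
  qed
  note assoc = assoc_mult_mat[of _ "Suc m" "Suc m" _ "Suc m" _ "Suc m"]
  have "(H * F)\<^sup>T * (H * F) = F\<^sup>T * ((H\<^sup>T * H) * F)"
    using H F by (simp add: transpose_mult[OF H F] assoc)
  also have "\<dots> = 1\<^sub>m (Suc m)" using F by (simp add: HH FF)
  finally have 1: "(H * F)\<^sup>T * (H * F) = 1\<^sub>m (Suc m)" .
  have "H * T = (H * H\<^sup>T) * (S * H)" unfolding T_def using H S by (simp add: assoc)
  then have HT: "H * T = S * H" using H S by (simp add: HH')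
  have "S * (H * F) = (H * T) * F" unfolding HT using H S F by (simp add: assoc)
  also have "\<dots> = H * (F * mat_diag (Suc m) (\<lambda>i. (e # es) ! i))" using H T F by (simp add: TF assoc)
  also have "\<dots> = (H * F) * mat_diag (Suc m) (\<lambda>i. (e # es) ! i)" using H F by (simp add: assoc mat_diag_dim)
  finally show ?case using 1 H F unfolding n by (intro exI[of _ "H * F"]) auto
qed

text \<open>Over the complex numbers the polynomial splits.  If \<open>C v = a v\<close> with \<open>C\<close> real
  and symmetric, then pairing with the conjugate vector gives \<open>cnj a = a\<close>, so every root is real and
  the factorization descends to the reals.\<close>

lemma symmetric_char_poly_splits:
  fixes S :: "real mat"
  assumes S: "S \<in> carrier_mat n n" and sym: "S\<^sup>T = S"
  shows "\<exists>es. char_poly S = (\<Prod>e\<leftarrow>es. [:-e, 1:])"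
proof -
  define C where "C = map_mat complex_of_real S"
  have C: "C \<in> carrier_mat n n" using S by (simp add: C_def)
  have "C\<^sup>T = map_mat complex_of_real (S\<^sup>T)" by (simp add: C_def map_mat_transpose)
  then have Csym: "C\<^sup>T = C" by (simp add: sym C_def)
  obtain as where as: "char_poly C = (\<Prod>a\<leftarrow>as. [:- a, 1:])" using char_poly_factorized[OF C] by blast
  have real: "complex_of_real (Re a) = a" if a: "a \<in> set as" for a
  proof -
    have "poly (char_poly C) a = 0" using a unfolding as by (auto simp: poly_prod_list prod_list_zero_iff)
    then have "eigenvalue C a" using eigenvalue_root_char_poly[OF C] by simp
    then obtain v where v: "v \<in> carrier_vec n" "v \<noteq> 0\<^sub>v n" "C *\<^sub>v v = a \<cdot>\<^sub>v v"
      using C by (auto simp: eigenvalue_def eigenvector_def)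
    define w where "w = map_vec cnj v"
    have w: "w \<in> carrier_vec n" using v by (simp add: w_def)
    have Cw: "C *\<^sub>v w = cnj a \<cdot>\<^sub>v w"
    proof (rule eq_vecI)
      fix i assume "i < dim_vec (cnj a \<cdot>\<^sub>v w)"
      then have i: "i < n" using w by simp
      have "(C *\<^sub>v w) $ i = cnj ((C *\<^sub>v v) $ i)"
        using i C v(1) by (simp add: scalar_prod_def w_def) (simp add: C_def)
      then show "(C *\<^sub>v w) $ i = (cnj a \<cdot>\<^sub>v w) $ i" using i v by (simp add: w_def)
    qed (use C w in auto)
    have "(C\<^sup>T *\<^sub>v w) \<bullet> v = w \<bullet> (C *\<^sub>v v)" using transpose_vec_mult_scalar[OF C v(1) w] by simp
    then have "cnj a * (w \<bullet> v) = a * (w \<bullet> v)" using v w by (simp add: Csym Cw)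
    moreover have "w \<bullet> v \<noteq> 0"
    proof
      assume 0: "w \<bullet> v = 0"
      have "w \<bullet> v = (\<Sum>i\<in>{0..<n}. complex_of_real ((cmod (v $ i))\<^sup>2))"
        using v(1) unfolding scalar_prod_def w_def
        by (auto intro!: sum.cong simp: complex_norm_square mult.commute[of "v $ _"] simp del: of_real_power)
      then have "(\<Sum>i\<in>{0..<n}. (cmod (v $ i))\<^sup>2) = 0" using 0 by (metis of_real_eq_0_iff of_real_sum)
      then have "\<forall>i\<in>{0..<n}. v $ i = 0" by (subst (asm) sum_nonneg_eq_0_iff) auto
      then have "v = 0\<^sub>v n" using v(1) by (intro eq_vecI) auto
      with v(2) show False by simp
    qed
    ultimately have "cnj a = a" by simp
    then show ?thesis by (metis Reals_cnj_iff of_real_Re)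
  qed
  define es where "es = map Re as"
  interpret map_of_real: map_poly_inj_idom_hom complex_of_real ..
  have "map_poly complex_of_real (\<Prod>e\<leftarrow>es. [:-e, 1:]) = (\<Prod>e\<leftarrow>es. [:- complex_of_real e, 1:])"
  proof (induction es)
    case (Cons e es)
    have "map_poly complex_of_real [:-e, 1:] = [:- complex_of_real e, 1:]" by (simp add: hom_distribs)
    with Cons show ?case by (simp only: list.map prod_list.Cons map_of_real.hom_mult)
  qed simp
  also have "\<dots> = (\<Prod>a\<leftarrow>as. [:- a, 1:])" unfolding es_def using real
    by (simp add: o_def cong: map_cong)
  also have "\<dots> = map_poly complex_of_real (char_poly S)"
    unfolding as[symmetric] C_def using S by (rule of_real_hom.char_poly_hom)
  finally have "char_poly S = (\<Prod>e\<leftarrow>es. [:-e, 1:])"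
    by (simp only: map_of_real.eq_iff)
  then show ?thesis by blast
qed

section \<open>Singular values and the Courant-Fischer principle\<close>

lemma proots_linear_factors: "proots (\<Prod>e\<leftarrow>es. [:-e, 1:]) = mset (es :: real list)"
proof (induction es)
  case (Cons e es)
  have "(\<Prod>e\<leftarrow>es. [:-e, 1:]) \<noteq> 0" by (auto simp: prod_list_zero_iff)
  then have "proots ([:-e, 1:] * (\<Prod>e\<leftarrow>es. [:-e, 1:])) = proots [:-e, 1:] + mset es"
    by (subst proots_mult) (use Cons in auto)
  then show ?case by (simp only: list.map prod_list.Cons proots_linear_factor) simp
qed simp

lemma det_mult_diag_conjugate:
  assumes "(S :: real mat) \<in> carrier_mat q q" "U \<in> carrier_mat q q" "U\<^sup>T * U = 1\<^sub>m q"
    "S * U = U * mat_diag q d"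
  shows "det S = (\<Prod>i<q. d i)"
proof -
  have UU: "det U * det U = 1"
  proof -
    have "det (U\<^sup>T * U) = 1" using assms by simp
    then show ?thesis using det_mult[of "U\<^sup>T" q U] det_transpose[OF assms(2)] assms(2) by simp
  qed
  have "det (S * U) = det (U * mat_diag q d)" using assms by simp
  then have "det S * det U = det U * det (mat_diag q d)"
    using det_mult[OF assms(1,2)] det_mult[OF assms(2) mat_diag_dim] by simp
  then have "det S * (det U * det U) = det (mat_diag q d) * (det U * det U)" by (simp add: ac_simps)
  then have "det S = det (mat_diag q d)" using UU by simp
  also have "\<dots> = prod_list (diag_mat (mat_diag q d))"
    by (rule det_upper_triangular[of _ q]) (auto simp: mat_diag_def upper_triangular_def)
  also have "\<dots> = (\<Prod>i<q. d i)"
    by (simp add: prod_list_diag_prod mat_diag_def atLeast0LessThan)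
  finally show ?thesis .
qed

text \<open>The columns of \<open>U\<close> are right singular vectors of \<open>M\<close>, and \<open>d\<close> lists the squared singular values in
  non-increasing order, continued to all \<open>q\<close> eigenvalues of \<open>M\<^sup>T M\<close>.\<close>

lemma right_singular_vectors:
  assumes M: "M \<in> carrier_mat p q"
  obtains U d where "U \<in> carrier_mat q q" "U\<^sup>T * U = 1\<^sub>m q" "U * U\<^sup>T = 1\<^sub>m q"
    "M\<^sup>T * M * U = U * mat_diag q d"
    "\<And>i. i < q \<Longrightarrow> 0 \<le> d i"
    "\<And>i j. i \<le> j \<Longrightarrow> j < q \<Longrightarrow> d j \<le> d i"
    "\<And>i. i < min p q \<Longrightarrow> sing_val (Suc i) M = sqrt (d i)"
proof -
  define S where "S = M\<^sup>T * M"
  have S: "S \<in> carrier_mat q q" using M by (simp add: S_def)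
  have "S\<^sup>T = S" using M by (simp add: S_def transpose_mult[of _ q p _ q])
  then obtain es0 where es0: "char_poly S = (\<Prod>e\<leftarrow>es0. [:-e, 1:])"
    using symmetric_char_poly_splits[OF S] by blast
  define es where "es = rev (sort es0)"
  have "mset es = mset es0" by (simp add: es_def)
  then have "(\<Prod>e\<leftarrow>es. [:-e, 1:]) = (\<Prod>e\<leftarrow>es0. [:-e, 1:])"
    by (simp only: prod_mset_prod_list[symmetric] mset_map)
  with es0 have es: "char_poly S = (\<Prod>e\<leftarrow>es. [:-e, 1:])" by simp
  have len: "length es = q" using char_poly_linear_factors_length[OF S es] .
  obtain U where U: "U \<in> carrier_mat q q" "U\<^sup>T * U = 1\<^sub>m q" "S * U = U * mat_diag q (\<lambda>i. es ! i)"
    using symmetric_diagonalization[OF S \<open>S\<^sup>T = S\<close> es] by blast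
  have U': "U * U\<^sup>T = 1\<^sub>m q" using mat_mult_left_right_inverse[OF _ U(1,2)] U(1) by simp
  have nonneg: "0 \<le> es ! i" if i: "i < q" for i
  proof -
    have "col (S * U) i = col (U * mat_diag q (\<lambda>i. es ! i)) i" by (simp add: U(3))
    then have "S *\<^sub>v col U i = U *\<^sub>v col (mat_diag q (\<lambda>i. es ! i)) i"
      by (simp only: col_mult2[OF S U(1) i] col_mult2[OF U(1) mat_diag_dim i])
    also have "\<dots> = es ! i \<cdot>\<^sub>v col U i"
      using i U(1) by (intro eq_vecI) (auto simp: mat_diag_def scalar_prod_def if_distrib cong: if_cong)
    finally have Sc: "S *\<^sub>v col U i = es ! i \<cdot>\<^sub>v col U i" .
    have "(U\<^sup>T * U) $$ (i, i) = 1" using i by (simp add: U(2))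
    then have c1: "col U i \<bullet> col U i = 1" using i U(1) by simp
    have ci: "col U i \<in> carrier_vec q" using U(1) i by simp
    have "(M *\<^sub>v col U i) \<bullet> (M *\<^sub>v col U i) = col U i \<bullet> (S *\<^sub>v col U i)"
      unfolding S_def by (rule scalar_prod_mult_mat_vec2[OF M ci ci])
    also have "\<dots> = es ! i" unfolding Sc using ci c1 by simp
    finally show ?thesis using scalar_prod_self_nonneg by metis
  qed
  have anti: "es ! j \<le> es ! i" if "i \<le> j" "j < q" for i j
  proof -
    have "sorted_wrt (\<ge>) es" by (simp add: es_def sorted_wrt_rev)
    then show ?thesis using that len by (cases "i = j") (auto simp: sorted_wrt_iff_nth_less)
  qed
  have sv: "sing_val (Suc i) M = sqrt (es ! i)" if "i < min p q" for i
    using that M len es0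
    by (simp add: sing_val_def singular_values_def S_def[symmetric] proots_linear_factors nth_map es_def)
  show ?thesis using that[OF U(1,2) U' _ nonneg anti sv] U(3) by (simp add: S_def)
qed

lemma norm_mult_right_singular_vectors:
  assumes M: "M \<in> carrier_mat p q" and U: "U \<in> carrier_mat q q" "U\<^sup>T * U = 1\<^sub>m q"
    and MU: "M\<^sup>T * M * U = U * mat_diag q d" and y: "y \<in> carrier_vec q"
  shows "((M :: real mat) *\<^sub>v (U *\<^sub>v y)) \<bullet> (M *\<^sub>v (U *\<^sub>v y)) = (\<Sum>i<q. d i * (y $ i)\<^sup>2)"
proof -
  have D: "mat_diag q d \<in> carrier_mat q q" by simp
  have Uy: "U *\<^sub>v y \<in> carrier_vec q" using U y by simp
  have "(M *\<^sub>v (U *\<^sub>v y)) \<bullet> (M *\<^sub>v (U *\<^sub>v y)) = (U *\<^sub>v y) \<bullet> ((M\<^sup>T * M) *\<^sub>v (U *\<^sub>v y))"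
    by (rule scalar_prod_mult_mat_vec2[OF M Uy Uy])
  also have "(M\<^sup>T * M) *\<^sub>v (U *\<^sub>v y) = U *\<^sub>v (mat_diag q d *\<^sub>v y)"
    using M U(1) y D by (metis MU assoc_mult_mat_vec mult_carrier_mat transpose_carrier_mat)
  also have "(U *\<^sub>v y) \<bullet> (U *\<^sub>v (mat_diag q d *\<^sub>v y)) = y \<bullet> (mat_diag q d *\<^sub>v y)"
    using scalar_prod_mult_mat_vec2[OF U(1) y mult_mat_vec_carrier[OF D y]] D y by (simp add: U(2))
  also have "\<dots> = (\<Sum>i<q. d i * (y $ i)\<^sup>2)"
  proof -
    have "(mat_diag q d *\<^sub>v y) $ i = d i * y $ i" if i: "i < q" for i
    proof -
      have "(mat_diag q d *\<^sub>v y) $ i = (\<Sum>l\<in>{0..<q}. (if i = l then d l else 0) * y $ l)"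
        using i y by (simp add: scalar_prod_def mat_diag_def)
      also have "\<dots> = (\<Sum>l\<in>{0..<q}. if i = l then d l * y $ l else 0)" by (intro sum.cong) auto
      finally show ?thesis using i by simp
    qed
    then have "mat_diag q d *\<^sub>v y = vec q (\<lambda>i. d i * y $ i)"
      by (intro eq_vecI) (auto simp: carrier_matD(1)[OF mat_diag_dim])
    then show ?thesis
      using y by (simp add: scalar_prod_def power2_eq_square ac_simps atLeast0LessThan)
  qed
  finally show ?thesis .
qed

lemma sing_val_nonneg:
  assumes "M \<in> carrier_mat p q" "1 \<le> j" "j \<le> min p q"
  shows "0 \<le> sing_val j M"
proof -
  obtain U d where d: "\<And>i. i < q \<Longrightarrow> 0 \<le> d i" "\<And>i. i < min p q \<Longrightarrow> sing_val (Suc i) M = sqrt (d i)"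
    using right_singular_vectors[OF assms(1)] by metis
  have j': "j - 1 < q" using assms(2,3) by auto
  have "sing_val (Suc (j - 1)) M = sqrt (d (j - 1))" using assms by (intro d(2)) auto
  then show ?thesis using assms(2) d(1)[OF j'] by simp
qed

text \<open>The rows of \<open>L\<close> are the first \<open>j - 1\<close> right singular vectors; on their orthogonal complement only
  the singular values from the \<open>j\<close>-th on matter.\<close>

lemma sing_val_small_subspace:
  assumes M: "M \<in> carrier_mat p q" and j: "1 \<le> j" "j \<le> min p q"
  obtains L where "L \<in> carrier_mat (j - 1) q"
    "\<And>x. x \<in> carrier_vec q \<Longrightarrow> L *\<^sub>v x = 0\<^sub>v (j - 1) \<Longrightarrow> (M *\<^sub>v x) \<bullet> (M *\<^sub>v x) \<le> (sing_val j M)\<^sup>2 * (x \<bullet> x)"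
proof -
  obtain U d where U: "U \<in> carrier_mat q q" "U\<^sup>T * U = 1\<^sub>m q" "U * U\<^sup>T = 1\<^sub>m q"
    "M\<^sup>T * M * U = U * mat_diag q d" and d: "\<And>i. i < q \<Longrightarrow> 0 \<le> d i"
    "\<And>i j. i \<le> j \<Longrightarrow> j < q \<Longrightarrow> d j \<le> d i"
    "\<And>i. i < min p q \<Longrightarrow> sing_val (Suc i) M = sqrt (d i)"
    using right_singular_vectors[OF M] by metis
  have j': "j - 1 < q" using assms(2,3) by auto
  have "sing_val (Suc (j - 1)) M = sqrt (d (j - 1))" using j by (intro d(3)) auto
  then have sv: "(sing_val j M)\<^sup>2 = d (j - 1)" using j d(1)[OF j'] by simp
  define L where "L = mat (j - 1) q (\<lambda>(i,l). U\<^sup>T $$ (i,l))"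
  show ?thesis
  proof (rule that)
    show "L \<in> carrier_mat (j - 1) q" by (simp add: L_def)
    fix x assume x: "x \<in> carrier_vec q" and Lx: "L *\<^sub>v x = 0\<^sub>v (j - 1)"
    define y where "y = U\<^sup>T *\<^sub>v x"
    have y: "y \<in> carrier_vec q" using U x by (simp add: y_def)
    have "U *\<^sub>v y = (U * U\<^sup>T) *\<^sub>v x" unfolding y_def using U(1) x by (subst assoc_mult_mat_vec[of _ q q _ q]) auto
    then have Uy: "U *\<^sub>v y = x" using U x by simp
    have y0: "y $ i = 0" if i: "i < j - 1" for i
    proof -
      have "i < q" using i j' by simp
      have "row (U\<^sup>T) i = row L i" using i j U(1) by (intro eq_vecI) (auto simp: L_def)
      moreover have "y $ i = row (U\<^sup>T) i \<bullet> x" "(L *\<^sub>v x) $ i = row L i \<bullet> x"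
        using i \<open>i < q\<close> U(1) by (simp_all add: y_def L_def)
      ultimately have "y $ i = (L *\<^sub>v x) $ i" by simp
      then show ?thesis using Lx i by simp
    qed
    have "(M *\<^sub>v x) \<bullet> (M *\<^sub>v x) = (\<Sum>i<q. d i * (y $ i)\<^sup>2)"
      using norm_mult_right_singular_vectors[OF M U(1,2,4) y] Uy by simp
    also have "\<dots> \<le> (\<Sum>i<q. d (j - 1) * (y $ i)\<^sup>2)"
    proof (rule sum_mono)
      fix i assume "i \<in> {..<q}"
      then show "d i * (y $ i)\<^sup>2 \<le> d (j - 1) * (y $ i)\<^sup>2"
        by (cases "i < j - 1") (auto simp: y0 intro!: mult_right_mono d(2))
    qed
    also have "\<dots> = d (j - 1) * (y \<bullet> y)"
      using y by (simp add: scalar_prod_def power2_eq_square sum_distrib_left atLeast0LessThan)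
    also have "y \<bullet> y = x \<bullet> x" using scalar_prod_isometry[OF U(1,2) y] Uy by simp
    finally show "(M *\<^sub>v x) \<bullet> (M *\<^sub>v x) \<le> (sing_val j M)\<^sup>2 * (x \<bullet> x)" by (simp add: sv)
  qed
qed

text \<open>The columns of \<open>B\<close> are the first \<open>j\<close> right singular vectors.\<close>

lemma sing_val_large_subspace:
  assumes M: "M \<in> carrier_mat p q" and j: "1 \<le> j" "j \<le> min p q"
  obtains B where "B \<in> carrier_mat q j" "B\<^sup>T * B = 1\<^sub>m j"
    "\<And>y. y \<in> carrier_vec j \<Longrightarrow> (sing_val j M)\<^sup>2 * (y \<bullet> y) \<le> (M *\<^sub>v (B *\<^sub>v y)) \<bullet> (M *\<^sub>v (B *\<^sub>v y))"
proof -
  obtain U d where U: "U \<in> carrier_mat q q" "U\<^sup>T * U = 1\<^sub>m q" "U * U\<^sup>T = 1\<^sub>m q"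
    "M\<^sup>T * M * U = U * mat_diag q d" and d: "\<And>i. i < q \<Longrightarrow> 0 \<le> d i"
    "\<And>i j. i \<le> j \<Longrightarrow> j < q \<Longrightarrow> d j \<le> d i"
    "\<And>i. i < min p q \<Longrightarrow> sing_val (Suc i) M = sqrt (d i)"
    using right_singular_vectors[OF M] by metis
  have j': "j - 1 < q" using assms(2,3) by auto
  have "sing_val (Suc (j - 1)) M = sqrt (d (j - 1))" using j by (intro d(3)) auto
  then have sv: "(sing_val j M)\<^sup>2 = d (j - 1)" using j d(1)[OF j'] by simp
  define J where "J = mat q j (\<lambda>(i,l). if i = l then 1 else 0 :: real)"
  have J: "J \<in> carrier_mat q j" by (simp add: J_def)
  have JJ: "J\<^sup>T * J = 1\<^sub>m j"
    using j by (intro eq_matI) (auto simp: J_def scalar_prod_def if_distrib cong: if_cong)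
  have UJ: "U * J \<in> carrier_mat q j" using U J by simp
  have "(U * J)\<^sup>T * (U * J) = J\<^sup>T * ((U\<^sup>T * U) * J)"
    using U(1) J by (simp add: transpose_mult[OF U(1) J] assoc_mult_mat[of _ _ q _ q _ j])
  then have 1: "(U * J)\<^sup>T * (U * J) = 1\<^sub>m j" using J by (simp add: U(2) JJ)
  show ?thesis
  proof (rule that[OF UJ 1])
    fix y :: "real vec" assume y: "y \<in> carrier_vec j"
    define z where "z = J *\<^sub>v y"
    have z: "z \<in> carrier_vec q" using J y by (simp add: z_def)
    have z0: "z $ i = 0" if "j \<le> i" "i < q" for i
      using that y by (simp add: z_def J_def scalar_prod_def)
    have "(sing_val j M)\<^sup>2 * (y \<bullet> y) = d (j - 1) * (z \<bullet> z)"
      using scalar_prod_isometry[OF J JJ y] by (simp add: sv z_def)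
    also have "\<dots> = (\<Sum>i<q. d (j - 1) * (z $ i)\<^sup>2)"
      using z by (simp add: scalar_prod_def power2_eq_square sum_distrib_left atLeast0LessThan)
    also have "\<dots> \<le> (\<Sum>i<q. d i * (z $ i)\<^sup>2)"
    proof (rule sum_mono)
      fix i assume "i \<in> {..<q}"
      then show "d (j - 1) * (z $ i)\<^sup>2 \<le> d i * (z $ i)\<^sup>2"
        using j by (cases "i < j") (auto simp: z0 intro!: mult_right_mono d(2))
    qed
    also have "\<dots> = (M *\<^sub>v (U *\<^sub>v z)) \<bullet> (M *\<^sub>v (U *\<^sub>v z))"
      using norm_mult_right_singular_vectors[OF M U(1,2,4) z] by simp
    also have "U *\<^sub>v z = (U * J) *\<^sub>v y" unfolding z_def using U(1) J y by simp
    finally show "(sing_val j M)\<^sup>2 * (y \<bullet> y) \<le> (M *\<^sub>v ((U * J) *\<^sub>v y)) \<bullet> (M *\<^sub>v ((U * J) *\<^sub>v y))" .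
  qed
qed

text \<open>This replaces every dimension count below: a subspace is represented by the matrix of its equations or by the
  matrix of a basis, and \<open>a\<close> equations on \<open>b > a\<close> unknowns have a nonzero solution since padding them with
  zero rows makes a singular square matrix.\<close>

lemma wide_matrix_kernel:
  assumes L: "(L :: real mat) \<in> carrier_mat a b" and "a < b"
  obtains v where "v \<in> carrier_vec b" "v \<noteq> 0\<^sub>v b" "L *\<^sub>v v = 0\<^sub>v a"
proof -
  \<comment> \<open>\<open>a < b\<close>, so the last row of \<open>K\<close> is zero.\<close>
  define K where "K = mat b b (\<lambda>(i,j). if i < a then L $$ (i,j) else 0)"
  have K: "K \<in> carrier_mat b b" by (simp add: K_def)
  have "det K = (\<Sum>j<b. K $$ (b - 1, j) * cofactor K (b - 1) j)"
    using \<open>a < b\<close> by (intro laplace_expansion_row[OF K]) auto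
  also have "\<dots> = 0" using \<open>a < b\<close> by (intro sum.neutral) (auto simp: K_def)
  finally obtain v where v: "v \<in> carrier_vec b" "v \<noteq> 0\<^sub>v b" "K *\<^sub>v v = 0\<^sub>v b"
    using det_0_iff_vec_prod_zero_field[OF K] by blast
  have "L *\<^sub>v v = 0\<^sub>v a"
  proof (rule eq_vecI)
    fix i assume "i < dim_vec (0\<^sub>v a)"
    then have i: "i < a" by simp
    then have "row L i = row K i" using L \<open>a < b\<close> by (intro eq_vecI) (auto simp: K_def)
    then have "(L *\<^sub>v v) $ i = (K *\<^sub>v v) $ i" using i L K \<open>a < b\<close> by simp
    then show "(L *\<^sub>v v) $ i = 0\<^sub>v a $ i" using i v(3) \<open>a < b\<close> by simp
  qed (use L in auto)
  with v show ?thesis by (intro that)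
qed

text \<open>The easy half of Courant-Fischer: \<open>j - 1\<close> equations cannot avoid the \<open>j\<close>-dimensional space on
  which \<open>M\<close> stretches by at least its \<open>j\<close>-th singular value.  All upper bounds on singular values below
  are obtained by exhibiting \<open>L\<close>, except for one that uses \<open>sing_val_large_subspace\<close> directly.\<close>

lemma sing_val_le:
  assumes M: "M \<in> carrier_mat p q" and j: "1 \<le> j" "j \<le> min p q"
    and L: "L \<in> carrier_mat (j - 1) q" and c: "0 \<le> c"
    and bound: "\<And>x. x \<in> carrier_vec q \<Longrightarrow> L *\<^sub>v x = 0\<^sub>v (j - 1) \<Longrightarrow> (M *\<^sub>v x) \<bullet> (M *\<^sub>v x) \<le> c\<^sup>2 * (x \<bullet> x)"
  shows "sing_val j M \<le> c"
proof -
  obtain B where B: "B \<in> carrier_mat q j" "B\<^sup>T * B = 1\<^sub>m j"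
    "\<And>y. y \<in> carrier_vec j \<Longrightarrow> (sing_val j M)\<^sup>2 * (y \<bullet> y) \<le> (M *\<^sub>v (B *\<^sub>v y)) \<bullet> (M *\<^sub>v (B *\<^sub>v y))"
    using sing_val_large_subspace[OF M j] by metis
  have "L * B \<in> carrier_mat (j - 1) j" using L B by simp
  then obtain y where y: "y \<in> carrier_vec j" "y \<noteq> 0\<^sub>v j" "(L * B) *\<^sub>v y = 0\<^sub>v (j - 1)"
    using wide_matrix_kernel[of "L * B" "j - 1" j] j by auto
  have By: "B *\<^sub>v y \<in> carrier_vec q" using B y by simp
  have "L *\<^sub>v (B *\<^sub>v y) = 0\<^sub>v (j - 1)" using y(3) L B(1) y(1) by simp
  with B(3)[OF y(1)] bound[OF By] have "(sing_val j M)\<^sup>2 * (y \<bullet> y) \<le> c\<^sup>2 * ((B *\<^sub>v y) \<bullet> (B *\<^sub>v y))" by simp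
  also have "(B *\<^sub>v y) \<bullet> (B *\<^sub>v y) = y \<bullet> y" by (rule scalar_prod_isometry[OF B(1,2) y(1)])
  finally have "(sing_val j M)\<^sup>2 * (y \<bullet> y) \<le> c\<^sup>2 * (y \<bullet> y)" .
  moreover have "0 < y \<bullet> y"
    using scalar_prod_self_nonneg[of y] scalar_prod_self_eq_0[OF y(1)] y(2) by fastforce
  ultimately have "(sing_val j M)\<^sup>2 \<le> c\<^sup>2" by simp
  then show ?thesis using c by (rule power2_le_imp_le)
qed

section \<open>Orthogonal invariance of singular values\<close>

text \<open>The Gram matrix does not change; the condition on the dimensions makes both lists equally long.\<close>

lemma singular_values_isometry:
  assumes Q: "Q \<in> carrier_mat m r" "Q\<^sup>T * Q = 1\<^sub>m r" and R: "R \<in> carrier_mat r n" and r: "min m n = min r n"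
  shows "singular_values (Q * R) = singular_values R"
proof -
  have "(Q * R)\<^sup>T * (Q * R) = R\<^sup>T * ((Q\<^sup>T * Q) * R)"
    using Q(1) R by (simp add: transpose_mult[OF Q(1) R] assoc_mult_mat[of _ n r _ m _ n] assoc_mult_mat[of _ r m _ r _ n])
  then have "(Q * R)\<^sup>T * (Q * R) = R\<^sup>T * R" using R by (simp add: Q(2))
  then show ?thesis using Q(1) R r by (simp add: singular_values_def)
qed

lemma singular_values_mult_orthogonal:
  assumes A: "A \<in> carrier_mat m n" and P: "P \<in> carrier_mat n n" "P\<^sup>T * P = 1\<^sub>m n"
  shows "singular_values (A * P) = singular_values A"
proof -
  have P': "P * P\<^sup>T = 1\<^sub>m n" using mat_mult_left_right_inverse[OF _ P] P(1) by simp
  have "(A * P)\<^sup>T * (A * P) = P\<^sup>T * (A\<^sup>T * A) * P"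
    using A P(1) by (simp add: transpose_mult[OF A P(1)] assoc_mult_mat[of _ n m _ n _ n]
        assoc_mult_mat[of _ n n _ m _ n] assoc_mult_mat[of _ n n _ n _ n])
  moreover have "similar_mat (P\<^sup>T * (A\<^sup>T * A) * P) (A\<^sup>T * A)"
    by (rule similar_matI[of _ _ "P\<^sup>T" P n]) (use A P P' in auto)
  ultimately have "char_poly ((A * P)\<^sup>T * (A * P)) = char_poly (A\<^sup>T * A)"
    using char_poly_similar by metis
  then show ?thesis using A P(1) by (simp add: singular_values_def)
qed

lemma volume_eq_sqrt_det_gram:
  assumes C: "C \<in> carrier_mat m k" and "k \<le> m"
  shows "volume C = sqrt (det (C\<^sup>T * C))"
proof -
  obtain U d where U: "U \<in> carrier_mat k k" "U\<^sup>T * U = 1\<^sub>m k"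
    "C\<^sup>T * C * U = U * mat_diag k d" and d: "\<And>i. i < k \<Longrightarrow> 0 \<le> d i"
    "\<And>i. i < min m k \<Longrightarrow> sing_val (Suc i) C = sqrt (d i)"
    using right_singular_vectors[OF C] by metis
  have mk: "min m k = k" using assms(2) by simp
  have "volume C = (\<Prod>i<k. sing_val (Suc i) C)"
    using C mk by (simp add: volume_def prod.atLeast1_atMost_eq)
  also have "\<dots> = (\<Prod>i<k. sqrt (d i))" using d(2) mk by simp
  also have "\<dots> = sqrt (\<Prod>i<k. d i)" by (induction k) (simp_all add: real_sqrt_mult)
  also have "(\<Prod>i<k. d i) = det (C\<^sup>T * C)"
    using det_mult_diag_conjugate[OF _ U] C by simp
  finally show ?thesis .
qed

section \<open>Volume as a Gram determinant and column exchange\<close>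

lemma det_permute_rows_and_columns:
  assumes G: "(G :: real mat) \<in> carrier_mat k k" and \<pi>: "\<pi> permutes {0..<k}"
  shows "det (mat k k (\<lambda>(i,j). G $$ (\<pi> i, \<pi> j))) = det G"
proof -
  have \<pi>_less: "\<pi> i < k" if "i < k" for i using permutes_in_image[OF \<pi>, of i] that by simp
  define G1 where "G1 = mat k k (\<lambda>(i,j). G $$ (i, \<pi> j))"
  have G1: "G1 \<in> carrier_mat k k" by (simp add: G1_def)
  have "mat k k (\<lambda>(i,j). G $$ (\<pi> i, \<pi> j)) = mat k k (\<lambda>(i,j). G1 $$ (\<pi> i, j))"
    by (rule eq_matI) (auto simp: G1_def \<pi>_less)
  then have 1: "det (mat k k (\<lambda>(i,j). G $$ (\<pi> i, \<pi> j))) = signof \<pi> * det G1"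
    using det_permute_rows[OF G1 \<pi>] by simp
  have "G1\<^sup>T = mat k k (\<lambda>(i,j). G\<^sup>T $$ (\<pi> i, j))"
    using G by (intro eq_matI) (auto simp: G1_def \<pi>_less)
  then have "det G1 = signof \<pi> * det G"
    using det_permute_rows[of "G\<^sup>T" k \<pi>] det_transpose[OF G1] det_transpose[OF G] G \<pi> by simp
  moreover have "signof \<pi> * (signof \<pi> * det G) = det G" by (simp add: sign_def)
  ultimately show ?thesis using 1 by simp
qed

lemma pick_atLeastLessThan:
  assumes "a < m" shows "pick {0..<m} a = a"
proof -
  have "{x \<in> {0..<m}. x < a} = {0..<a}" using assms by auto
  then show ?thesis using pick_card_in_set[of a "{0..<m}"] assms by simp
qed

lemma bij_betw_pick:
  assumes "finite J" shows "bij_betw (pick J) {0..<card J} J"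
proof (rule bij_betwI')
  fix a b assume "a \<in> {0..<card J}" "b \<in> {0..<card J}"
  then show "(pick J a = pick J b) = (a = b)"
    using pick_mono[of a J b] pick_mono[of b J a] by (metis atLeastLessThan_iff less_irrefl linorder_neqE_nat)
next
  fix a assume "a \<in> {0..<card J}"
  then show "pick J a \<in> J" by (intro pick_in_set) auto
next
  fix x assume x: "x \<in> J"
  then have "pick J (card {a \<in> J. a < x}) = x" by (rule pick_card_in_set)
  moreover have "card {a \<in> J. a < x} < card J" using x assms by (intro psubset_card_mono) auto
  ultimately show "\<exists>a\<in>{0..<card J}. x = pick J a" by (metis atLeastLessThan_iff le0)
qed

text \<open>A submatrix lists its columns in increasing order, whereas column exchanges are most easily described by a
  selection function \<open>f\<close>.  The two orders differ by a permutation, which acts on rows and columns of the Gram matrix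
  simultaneously and so leaves its determinant alone.\<close>

lemma volume_column_selection:
  assumes A: "A \<in> carrier_mat m n" and km: "k \<le> m"
    and inj: "inj_on f {0..<k}" and ran: "f ` {0..<k} \<subseteq> {0..<n}"
  shows "volume (submatrix A {0..<m} (f ` {0..<k}))
    = sqrt (det (mat k k (\<lambda>(i,j). col A (f i) \<bullet> col A (f j))))"
proof -
  define J where "J = f ` {0..<k}"
  define C where "C = submatrix A {0..<m} J"
  have J: "finite J" "card J = k" using inj by (simp_all add: J_def card_image)
  have set: "{i. i < dim_row A \<and> i \<in> {0..<m}} = {0..<m}" "{j. j < dim_col A \<and> j \<in> J} = J"
    using A ran by (auto simp: J_def)
  have C: "C \<in> carrier_mat m k"
    unfolding C_def by (rule carrier_matI) (simp_all only: dim_submatrix set J card_atLeastLessThan diff_zero)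
  have bp: "bij_betw (pick J) {0..<k} J" using bij_betw_pick[OF J(1)] J(2) by simp
  have pick_less: "pick J b < n" if "b < k" for b
    using bij_betwE[OF bp] that ran by (fastforce simp: J_def)
  have colC: "col C b = col A (pick J b)" if b: "b < k" for b
  proof (rule eq_vecI)
    fix a assume "a < dim_vec (col A (pick J b))"
    then have a: "a < m" using A by simp
    have "C $$ (a, b) = A $$ (pick {0..<m} a, pick J b)"
      unfolding C_def by (rule submatrix_index) (simp_all only: set J card_atLeastLessThan diff_zero a b)
    then show "col C b $ a = col A (pick J b) $ a"
      using a b C A pick_less[OF b] by (simp add: pick_atLeastLessThan)
  qed (use A C in auto)
  \<comment> \<open>\<open>\<pi>\<close> translates the position in increasing order into the argument of \<open>f\<close>.\<close>
  define \<pi> where "\<pi> b = (if b \<in> {0..<k} then inv_into {0..<k} f (pick J b) else b)" for b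
  have "bij_betw (inv_into {0..<k} f \<circ> pick J) {0..<k} {0..<k}"
    by (rule bij_betw_trans[OF bp]) (simp add: J_def bij_betw_inv_into inj inj_on_imp_bij_betw)
  then have "bij_betw \<pi> {0..<k} {0..<k}"
    by (rule iffD1[OF bij_betw_cong, rotated]) (auto simp: \<pi>_def)
  then have \<pi>: "\<pi> permutes {0..<k}" by (rule bij_imp_permutes) (auto simp: \<pi>_def)
  have \<pi>_less: "\<pi> i < k" if "i < k" for i using permutes_in_image[OF \<pi>, of i] that by simp
  have f\<pi>: "f (\<pi> b) = pick J b" if "b < k" for b
    using that bij_betwE[OF bp] by (auto simp: \<pi>_def J_def f_inv_into_f)
  define G where "G = mat k k (\<lambda>(i,j). col A (f i) \<bullet> col A (f j))"
  have "C\<^sup>T * C = mat k k (\<lambda>(i,j). G $$ (\<pi> i, \<pi> j))"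
    using C by (intro eq_matI) (auto simp: colC G_def \<pi>_less f\<pi>)
  then have "det (C\<^sup>T * C) = det G"
    using det_permute_rows_and_columns[of G k \<pi>] \<pi> by (simp add: G_def)
  with volume_eq_sqrt_det_gram[OF C km] show ?thesis by (simp add: C_def J_def G_def)
qed

text \<open>Expand along column \<open>i\<close>: its cofactors do not see the changed entry.\<close>

lemma det_add_to_diagonal_entry:
  assumes H: "(H :: real mat) \<in> carrier_mat k k" and i: "i < k"
  shows "det (mat k k (\<lambda>(a,b). H $$ (a,b) + (if a = i \<and> b = i then t else 0))) = det H + t * cofactor H i i"
proof -
  define H' where "H' = mat k k (\<lambda>(a,b). H $$ (a,b) + (if a = i \<and> b = i then t else 0))"
  have H': "H' \<in> carrier_mat k k" by (simp add: H'_def)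
  have cof: "cofactor H' a i = cofactor H a i" if "a < k" for a
  proof -
    have "mat_delete H' a i = mat_delete H a i"
      unfolding mat_delete_def using H that i by (intro eq_matI) (auto simp: H'_def)
    then show ?thesis by (simp add: cofactor_def)
  qed
  have entry: "H' $$ (a,i) = H $$ (a,i) + (if a = i then t else 0)" if "a < k" for a
    using that i by (simp add: H'_def)
  have "det H' = (\<Sum>a<k. H' $$ (a,i) * cofactor H' a i)" by (rule laplace_expansion_column[OF H' i])
  also have "\<dots> = (\<Sum>a<k. H $$ (a,i) * cofactor H a i + (if a = i then t * cofactor H i i else 0))"
    using i by (intro sum.cong) (auto simp: cof entry algebra_simps)
  also have "\<dots> = det H + t * cofactor H i i"
    using i by (simp add: sum.distrib laplace_expansion_column[OF H i, symmetric])
  finally show ?thesis by (simp add: H'_def)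
qed

lemma cofactor_eq_det_times_inverse:
  assumes A: "(A :: real mat) \<in> carrier_mat k k" and V: "V \<in> carrier_mat k k" and AV: "A * V = 1\<^sub>m k"
    and ij: "i < k" "j < k"
  shows "cofactor A j i = det A * V $$ (i,j)"
proof -
  have "adj_mat A = adj_mat A * (A * V)" using adj_mat(1)[OF A] by (simp add: AV)
  also have "\<dots> = (adj_mat A * A) * V" using adj_mat(1)[OF A] A V by simp
  also have "\<dots> = det A \<cdot>\<^sub>m V" using V by (simp add: adj_mat(3)[OF A] mult_smult_assoc_mat[of _ k k _ k])
  finally have "adj_mat A $$ (i,j) = det A * V $$ (i,j)" using V ij by simp
  then show ?thesis using A ij by (simp add: adj_mat_def)
qed

lemma det_replace_column:
  assumes A: "(A :: real mat) \<in> carrier_mat k k" and V: "V \<in> carrier_mat k k" and AV: "A * V = 1\<^sub>m k"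
    and v: "v \<in> carrier_vec k" and i: "i < k"
  shows "det (mat k k (\<lambda>(a,b). if b = i then v $ a else A $$ (a,b))) = det A * (V *\<^sub>v v) $ i"
proof -
  have Vv: "V *\<^sub>v v \<in> carrier_vec k" using V v by simp
  have "A *\<^sub>v (V *\<^sub>v v) = v"
    using assoc_mult_mat_vec[OF A V v] v by (simp add: AV)
  then have "det (replace_col A v i) = (V *\<^sub>v v) $ i * det A"
    using cramer_lemma_mat[OF A Vv i] by simp
  moreover have "replace_col A v i = mat k k (\<lambda>(a,b). if b = i then v $ a else A $$ (a,b))"
    using A by (simp add: replace_col_def)
  ultimately show ?thesis by simp
qed

text \<open>The Gram determinant after replacing column \<open>i\<close> of \<open>[A; 0]\<close> by \<open>[v; w]\<close> with \<open>w \<bullet> w = t\<close>.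
  For \<open>t = 0\<close> it is the square of a determinant given by Cramer's rule.  The part \<open>w\<close> is orthogonal to all
  other columns and only adds \<open>t\<close> to one diagonal entry, hence contributes \<open>t\<close> times the complementary
  minor.  That minor involves only the columns that stay, so it can be
  computed from \<open>A\<close> itself, where it is \<open>det (A\<^sup>T A)\<close> times a diagonal entry of \<open>(A\<^sup>T A)\<inverse> = V V\<^sup>T\<close>.\<close>

lemma det_gram_exchange_column:
  assumes A: "(A :: real mat) \<in> carrier_mat k k" and V: "V \<in> carrier_mat k k" and AV: "A * V = 1\<^sub>m k"
    and v: "v \<in> carrier_vec k" and i: "i < k"
  shows "det (mat k k (\<lambda>(a,b). (if a = i then v else col A a) \<bullet> (if b = i then v else col A b)
      + (if a = i \<and> b = i then t else 0)))
    = (det A)\<^sup>2 * (((V *\<^sub>v v) $ i)\<^sup>2 + t * (row V i \<bullet> row V i))"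
proof -
  define N where "N = mat k k (\<lambda>(a,b). if b = i then v $ a else A $$ (a,b))"
  have N: "N \<in> carrier_mat k k" by (simp add: N_def)
  have colN: "col N b = (if b = i then v else col A b)" if "b < k" for b
    using that A v by (intro eq_vecI) (auto simp: N_def)
  have NN: "N\<^sup>T * N \<in> carrier_mat k k" using N by simp
  have AA: "A\<^sup>T * A \<in> carrier_mat k k" using A by simp
  have VV: "V * V\<^sup>T \<in> carrier_mat k k" using V by simp
  have "mat k k (\<lambda>(a,b). (if a = i then v else col A a) \<bullet> (if b = i then v else col A b)
      + (if a = i \<and> b = i then t else 0))
    = mat k k (\<lambda>(a,b). (N\<^sup>T * N) $$ (a,b) + (if a = i \<and> b = i then t else 0))"
    using N by (intro eq_matI) (auto simp: colN)
  then have "det (mat k k (\<lambda>(a,b). (if a = i then v else col A a) \<bullet> (if b = i then v else col A b)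
      + (if a = i \<and> b = i then t else 0))) = det (N\<^sup>T * N) + t * cofactor (N\<^sup>T * N) i i"
    using det_add_to_diagonal_entry[OF NN i, of t] by simp
  also have "det (N\<^sup>T * N) = (det A * (V *\<^sub>v v) $ i)\<^sup>2"
    using N det_mult[of "N\<^sup>T" k N] det_transpose[OF N] det_replace_column[OF A V AV v i]
    by (simp add: N_def[symmetric] power2_eq_square)
  also have "cofactor (N\<^sup>T * N) i i = cofactor (A\<^sup>T * A) i i"
  proof -
    have "mat_delete (N\<^sup>T * N) i i = mat_delete (A\<^sup>T * A) i i"
      unfolding mat_delete_def using A N i by (intro eq_matI) (auto simp: colN)
    then show ?thesis by (simp add: cofactor_def)
  qed
  also have "\<dots> = det (A\<^sup>T * A) * (V * V\<^sup>T) $$ (i,i)"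
  proof (rule cofactor_eq_det_times_inverse[OF AA VV _ i i])
    have VA: "V * A = 1\<^sub>m k" using mat_mult_left_right_inverse[OF A V AV] .
    have "(A\<^sup>T * A) * (V * V\<^sup>T) = A\<^sup>T * ((A * V) * V\<^sup>T)"
      using A V by (simp add: assoc_mult_mat[of _ k k _ k _ k])
    also have "\<dots> = (V * A)\<^sup>T" using A V by (simp add: AV transpose_mult[OF V A])
    finally show "(A\<^sup>T * A) * (V * V\<^sup>T) = 1\<^sub>m k" by (simp add: VA)
  qed
  also have "det (A\<^sup>T * A) = (det A)\<^sup>2"
    using A det_mult[of "A\<^sup>T" k A] det_transpose[OF A] by (simp add: power2_eq_square)
  also have "(V * V\<^sup>T) $$ (i,i) = row V i \<bullet> row V i" using V i by simp
  finally show ?thesis by (simp add: power_mult_distrib algebra_simps)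
qed

section \<open>Singular values of a block triangular matrix\<close>

definition frobenius_sq :: "real mat \<Rightarrow> real" where
  "frobenius_sq M = (\<Sum>i<dim_row M. row M i \<bullet> row M i)"

lemma frobenius_sq_nonneg: "0 \<le> frobenius_sq M"
  unfolding frobenius_sq_def by (intro sum_nonneg scalar_prod_self_nonneg)

lemma norm_mult_le_frobenius:
  assumes M: "M \<in> carrier_mat p q" and x: "x \<in> carrier_vec q"
  shows "(M *\<^sub>v x) \<bullet> (M *\<^sub>v x) \<le> frobenius_sq M * (x \<bullet> x)"
proof -
  have "(M *\<^sub>v x) \<bullet> (M *\<^sub>v x) = (\<Sum>i<p. (row M i \<bullet> x)\<^sup>2)"
    using M by (simp add: scalar_prod_def[of "M *\<^sub>v x"] power2_eq_square atLeast0LessThan)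
  also have "\<dots> \<le> (\<Sum>i<p. (row M i \<bullet> row M i) * (x \<bullet> x))"
    using M x by (intro sum_mono scalar_prod_cauchy_schwarz[of _ q]) auto
  also have "\<dots> = frobenius_sq M * (x \<bullet> x)" using M by (simp add: frobenius_sq_def sum_distrib_right)
  finally show ?thesis .
qed

text \<open>The factor 2 is the price for avoiding square roots; it is why \<open>2 K\<close> and not \<open>K\<close> appears in the final
  factor.\<close>

lemma norm_diff_le:
  assumes "(x :: real vec) \<in> carrier_vec n" "y \<in> carrier_vec n"
  shows "(x - y) \<bullet> (x - y) \<le> 2 * (x \<bullet> x) + 2 * (y \<bullet> y)"
proof -
  have "(x - y) \<bullet> (x - y) = (\<Sum>i<n. (x $ i - y $ i)\<^sup>2)"
    using assms by (simp add: scalar_prod_def power2_eq_square atLeast0LessThan)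
  also have "\<dots> \<le> (\<Sum>i<n. 2 * (x $ i * x $ i) + 2 * (y $ i * y $ i))"
  proof (rule sum_mono)
    fix i
    show "(x $ i - y $ i)\<^sup>2 \<le> 2 * (x $ i * x $ i) + 2 * (y $ i * y $ i)"
      using zero_le_power2[of "x $ i + y $ i"] by (simp add: power2_eq_square algebra_simps)
  qed
  also have "\<dots> = 2 * (x \<bullet> x) + 2 * (y \<bullet> y)"
    using assms by (simp add: scalar_prod_def sum.distrib sum_distrib_left atLeast0LessThan)
  finally show ?thesis .
qed

lemma append_vec_eq_zero:
  assumes "(u :: real vec) \<in> carrier_vec a" "v \<in> carrier_vec b"
  shows "u @\<^sub>v v = 0\<^sub>v (a + b) \<longleftrightarrow> u = 0\<^sub>v a \<and> v = 0\<^sub>v b"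
proof -
  have "0\<^sub>v a @\<^sub>v 0\<^sub>v b = (0\<^sub>v (a + b) :: real vec)" by (intro eq_vecI) auto
  then show ?thesis using append_vec_eq[OF assms(1), of "0\<^sub>v a" v "0\<^sub>v b"] by auto
qed

text \<open>The triangular factor of a partial QR factorization, with \<open>k + l\<close> columns and \<open>k + s\<close> rows; \<open>V\<close>
  is the inverse of \<open>R11\<close>.\<close>

locale triangular_blocks =
  fixes k l s :: nat and R11 R12 R22 V :: "real mat"
  assumes R11: "R11 \<in> carrier_mat k k" and R12: "R12 \<in> carrier_mat k l"
    and R22: "R22 \<in> carrier_mat s l" and V: "V \<in> carrier_mat k k"
    and inverse: "R11 * V = 1\<^sub>m k" "V * R11 = 1\<^sub>m k"
begin

definition "R = four_block_mat R11 R12 (0\<^sub>m s k) R22"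
definition "R_top = four_block_mat R11 R12 (0\<^sub>m s k) (0\<^sub>m s l)"
definition "R_rest = four_block_mat (0\<^sub>m k k) (0\<^sub>m k l) (0\<^sub>m s k) R22"

lemma R_carrier: "R \<in> carrier_mat (k + s) (k + l)"
  and R_top_carrier: "R_top \<in> carrier_mat (k + s) (k + l)"
  and R_rest_carrier: "R_rest \<in> carrier_mat (k + s) (k + l)"
  using R11 R22 by (auto simp: R_def R_top_def R_rest_def)

lemma mult_blocks:
  assumes x: "x1 \<in> carrier_vec k" "x2 \<in> carrier_vec l"
  shows "R *\<^sub>v (x1 @\<^sub>v x2) = (R11 *\<^sub>v x1 + R12 *\<^sub>v x2) @\<^sub>v (R22 *\<^sub>v x2)"
    and "R_top *\<^sub>v (x1 @\<^sub>v x2) = (R11 *\<^sub>v x1 + R12 *\<^sub>v x2) @\<^sub>v 0\<^sub>v s"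
    and "R_rest *\<^sub>v (x1 @\<^sub>v x2) = 0\<^sub>v k @\<^sub>v (R22 *\<^sub>v x2)"
proof -
  have [simp]: "0\<^sub>m a b *\<^sub>v v = 0\<^sub>v a" if "v \<in> carrier_vec b" for a b and v :: "real vec"
    using that by (intro eq_vecI) auto
  have c: "R22 *\<^sub>v x2 \<in> carrier_vec s" "R11 *\<^sub>v x1 + R12 *\<^sub>v x2 \<in> carrier_vec k"
    using R11 R12 R22 x by auto
  show "R *\<^sub>v (x1 @\<^sub>v x2) = (R11 *\<^sub>v x1 + R12 *\<^sub>v x2) @\<^sub>v (R22 *\<^sub>v x2)"
    unfolding R_def by (subst four_block_mat_mult_vec[OF R11 R12 _ R22 x]) (use x c in auto)
  show "R_top *\<^sub>v (x1 @\<^sub>v x2) = (R11 *\<^sub>v x1 + R12 *\<^sub>v x2) @\<^sub>v 0\<^sub>v s"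
    unfolding R_top_def by (subst four_block_mat_mult_vec[OF R11 R12 _ _ x]) (use x c in auto)
  show "R_rest *\<^sub>v (x1 @\<^sub>v x2) = 0\<^sub>v k @\<^sub>v (R22 *\<^sub>v x2)"
    unfolding R_rest_def by (subst four_block_mat_mult_vec[OF _ _ _ R22 x]) (use x c in auto)
qed

lemma norm_blocks:
  assumes x: "x1 \<in> carrier_vec k" "x2 \<in> carrier_vec l"
  defines "u \<equiv> R11 *\<^sub>v x1 + R12 *\<^sub>v x2" and "v \<equiv> R22 *\<^sub>v x2" and "x \<equiv> x1 @\<^sub>v x2"
  shows "(R *\<^sub>v x) \<bullet> (R *\<^sub>v x) = u \<bullet> u + v \<bullet> v"
    and "(R_top *\<^sub>v x) \<bullet> (R_top *\<^sub>v x) = u \<bullet> u"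
    and "(R_rest *\<^sub>v x) \<bullet> (R_rest *\<^sub>v x) = v \<bullet> v"
    and "x \<bullet> x = x1 \<bullet> x1 + x2 \<bullet> x2"
proof -
  have c: "v \<in> carrier_vec s" "u \<in> carrier_vec k"
    using R11 R12 R22 x unfolding u_def v_def by auto
  note sp = scalar_prod_append[OF c(2) c(1) c(2) c(1)] scalar_prod_append[of u k "0\<^sub>v s" s u "0\<^sub>v s"]
    scalar_prod_append[of "0\<^sub>v k" k v s "0\<^sub>v k" v] scalar_prod_append[OF x x]
  show "(R *\<^sub>v x) \<bullet> (R *\<^sub>v x) = u \<bullet> u + v \<bullet> v"
    "(R_top *\<^sub>v x) \<bullet> (R_top *\<^sub>v x) = u \<bullet> u"
    "(R_rest *\<^sub>v x) \<bullet> (R_rest *\<^sub>v x) = v \<bullet> v"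
    "x \<bullet> x = x1 \<bullet> x1 + x2 \<bullet> x2"
    unfolding x_def mult_blocks[OF x] u_def[symmetric] v_def[symmetric] using c sp by auto
qed

lemma split_vec:
  assumes "x \<in> carrier_vec (k + l)"
  obtains x1 x2 where "x1 \<in> carrier_vec k" "x2 \<in> carrier_vec l" "x = x1 @\<^sub>v x2"
  using assms vec_first_last_append[OF assms] by (metis vec_first_carrier vec_last_carrier)

text \<open>\<open>R_top\<close> is \<open>R\<close> followed by an orthogonal projection, so the equations that work for \<open>R\<close> work for
  \<open>R_top\<close>.\<close>

lemma sing_val_top_le:
  assumes j: "1 \<le> j" "j \<le> min (k + s) (k + l)"
  shows "sing_val j R_top \<le> sing_val j R"
proof -
  obtain L where L: "L \<in> carrier_mat (j - 1) (k + l)"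
    "\<And>x. x \<in> carrier_vec (k + l) \<Longrightarrow> L *\<^sub>v x = 0\<^sub>v (j - 1) \<Longrightarrow> (R *\<^sub>v x) \<bullet> (R *\<^sub>v x) \<le> (sing_val j R)\<^sup>2 * (x \<bullet> x)"
    using sing_val_small_subspace[OF R_carrier j] by metis
  show ?thesis
  proof (rule sing_val_le[OF R_top_carrier j L(1) sing_val_nonneg[OF R_carrier j]])
    fix x assume x: "x \<in> carrier_vec (k + l)" and Lx: "L *\<^sub>v x = 0\<^sub>v (j - 1)"
    obtain x1 x2 where x12: "x1 \<in> carrier_vec k" "x2 \<in> carrier_vec l" "x = x1 @\<^sub>v x2"
      using split_vec[OF x] .
    have "(R_top *\<^sub>v x) \<bullet> (R_top *\<^sub>v x) \<le> (R *\<^sub>v x) \<bullet> (R *\<^sub>v x)"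
      using norm_blocks[OF x12(1,2)] scalar_prod_self_nonneg[of "R22 *\<^sub>v x2"] by (simp add: x12(3))
    with L(2)[OF x Lx] show "(R_top *\<^sub>v x) \<bullet> (R_top *\<^sub>v x) \<le> (sing_val j R)\<^sup>2 * (x \<bullet> x)" by simp
  qed
qed

text \<open>The \<open>k\<close> equations \<open>[R11 R12] x = 0\<close>, added to \<open>j - 1\<close> equations for \<open>R_rest\<close>, make \<open>R\<close> and
  \<open>R_rest\<close> agree.\<close>

lemma sing_val_rest_ge:
  assumes j: "1 \<le> j" "j \<le> min s l"
  shows "sing_val (k + j) R \<le> sing_val j R_rest"
proof -
  have j': "j \<le> min (k + s) (k + l)" using j by simp
  have kj: "1 \<le> k + j" "k + j \<le> min (k + s) (k + l)" using j by auto
  obtain L where L: "L \<in> carrier_mat (j - 1) (k + l)"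
    "\<And>x. x \<in> carrier_vec (k + l) \<Longrightarrow> L *\<^sub>v x = 0\<^sub>v (j - 1)
      \<Longrightarrow> (R_rest *\<^sub>v x) \<bullet> (R_rest *\<^sub>v x) \<le> (sing_val j R_rest)\<^sup>2 * (x \<bullet> x)"
    using sing_val_small_subspace[OF R_rest_carrier j(1) j'] by metis
  define T where "T = mat k (k + l) (\<lambda>(a,b). R_top $$ (a,b))"
  have T: "T \<in> carrier_mat k (k + l)" by (simp add: T_def)
  \<comment> \<open>\<open>T\<close> consists of the rows \<open>[R11 R12]\<close> of \<open>R_top\<close>; its zero rows are dropped, as they would count as equations.\<close>
  have TL: "T @\<^sub>r L \<in> carrier_mat (k + j - 1) (k + l)"
    using carrier_append_rows[OF T L(1)] j(1) by simp
  show ?thesis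
  proof (rule sing_val_le[OF R_carrier kj TL sing_val_nonneg[OF R_rest_carrier j(1) j']])
    fix x assume x: "x \<in> carrier_vec (k + l)" and TLx: "(T @\<^sub>r L) *\<^sub>v x = 0\<^sub>v (k + j - 1)"
    obtain x1 x2 where x12: "x1 \<in> carrier_vec k" "x2 \<in> carrier_vec l" "x = x1 @\<^sub>v x2"
      using split_vec[OF x] .
    have "k + j - 1 = k + (j - 1)" using j(1) by simp
    then have "(T *\<^sub>v x) @\<^sub>v (L *\<^sub>v x) = 0\<^sub>v (k + (j - 1))"
      using TLx mat_mult_append[OF T L(1) x] by simp
    then have 0: "T *\<^sub>v x = 0\<^sub>v k" "L *\<^sub>v x = 0\<^sub>v (j - 1)"
      using append_vec_eq_zero[of "T *\<^sub>v x" k "L *\<^sub>v x" "j - 1"] T L(1) x by auto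
    define u where "u = R11 *\<^sub>v x1 + R12 *\<^sub>v x2"
    have u: "u \<in> carrier_vec k" using R11 R12 x12 by (simp add: u_def)
    have "u = 0\<^sub>v k"
    proof (rule eq_vecI)
      fix i assume "i < dim_vec (0\<^sub>v k)"
      then have i: "i < k" by simp
      have "row T i = row R_top i" using i R_top_carrier by (intro eq_vecI) (auto simp: T_def)
      moreover have "(T *\<^sub>v x) $ i = row T i \<bullet> x" "(R_top *\<^sub>v x) $ i = row R_top i \<bullet> x"
        using i T R_top_carrier by simp_all
      ultimately have "(R_top *\<^sub>v x) $ i = 0" using 0(1) i by simp
      then have "(u @\<^sub>v 0\<^sub>v s) $ i = 0" using mult_blocks(2)[OF x12(1,2)] by (simp add: x12(3) u_def)
      then show "u $ i = 0\<^sub>v k $ i" using u i by simp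
    qed (use u in auto)
    then have "(R *\<^sub>v x) \<bullet> (R *\<^sub>v x) = (R_rest *\<^sub>v x) \<bullet> (R_rest *\<^sub>v x)"
      using norm_blocks[OF x12(1,2)] by (simp add: x12(3) u_def)
    with L(2)[OF x 0(2)] show "(R *\<^sub>v x) \<bullet> (R *\<^sub>v x) \<le> (sing_val j R_rest)\<^sup>2 * (x \<bullet> x)" by simp
  qed
qed

lemma norm_le_frobenius_inverse:
  assumes u: "u \<in> carrier_vec k"
  shows "u \<bullet> u \<le> frobenius_sq V * ((R11 *\<^sub>v u) \<bullet> (R11 *\<^sub>v u))"
proof -
  have Ru: "R11 *\<^sub>v u \<in> carrier_vec k" using R11 u by simp
  have "V *\<^sub>v (R11 *\<^sub>v u) = u" using assoc_mult_mat_vec[OF V R11 u] u by (simp add: inverse)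
  then show ?thesis using norm_mult_le_frobenius[OF V Ru] by simp
qed

text \<open>The leading \<open>k\<close> singular values of \<open>R_top\<close> are no smaller than those of \<open>R11\<close>, which are at least the
  reciprocal of the norm of \<open>V\<close>: fewer than \<open>k\<close> equations admit a nonzero solution supported
  on the first \<open>k\<close> coordinates, and there \<open>R_top\<close> acts as \<open>R11\<close>.\<close>

lemma sing_val_top_ge_inverse:
  assumes j: "1 \<le> j" "j \<le> k"
  shows "1 \<le> frobenius_sq V * (sing_val j R_top)\<^sup>2"
proof -
  have j': "j \<le> min (k + s) (k + l)" using j by simp
  obtain L where L: "L \<in> carrier_mat (j - 1) (k + l)"
    "\<And>x. x \<in> carrier_vec (k + l) \<Longrightarrow> L *\<^sub>v x = 0\<^sub>v (j - 1)
      \<Longrightarrow> (R_top *\<^sub>v x) \<bullet> (R_top *\<^sub>v x) \<le> (sing_val j R_top)\<^sup>2 * (x \<bullet> x)"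
    using sing_val_small_subspace[OF R_top_carrier j(1) j'] by metis
  define J where "J = four_block_mat (1\<^sub>m k) (0\<^sub>m k 0) (0\<^sub>m l k) (0\<^sub>m l 0 :: real mat)"
  have J: "J \<in> carrier_mat (k + l) k" by (rule carrier_matI) (auto simp: J_def)
  have LJ: "L * J \<in> carrier_mat (j - 1) k" using L(1) J by simp
  have "j - 1 < k" using j by simp
  obtain u where u: "u \<in> carrier_vec k" "u \<noteq> 0\<^sub>v k" "(L * J) *\<^sub>v u = 0\<^sub>v (j - 1)"
    using wide_matrix_kernel[OF LJ \<open>j - 1 < k\<close>] by blast
  have Ju: "J *\<^sub>v u = u @\<^sub>v 0\<^sub>v l"
  proof -
    have e: "u = u @\<^sub>v 0\<^sub>v 0" using u by (intro eq_vecI) auto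
    have "J *\<^sub>v (u @\<^sub>v 0\<^sub>v 0) = (1\<^sub>m k *\<^sub>v u + 0\<^sub>m k 0 *\<^sub>v 0\<^sub>v 0) @\<^sub>v (0\<^sub>m l k *\<^sub>v u + 0\<^sub>m l 0 *\<^sub>v 0\<^sub>v 0)"
      unfolding J_def by (rule four_block_mat_mult_vec) (use u in auto)
    also have "\<dots> = u @\<^sub>v 0\<^sub>v l" using u by (intro arg_cong2[of _ _ _ _ append_vec] eq_vecI) (auto simp: scalar_prod_def)
    finally show ?thesis using e by simp
  qed
  have zl: "0\<^sub>v l \<in> carrier_vec l" by simp
  have c: "u @\<^sub>v 0\<^sub>v l \<in> carrier_vec (k + l)" using u by simp
  have "L *\<^sub>v (u @\<^sub>v 0\<^sub>v l) = 0\<^sub>v (j - 1)" using u(3) assoc_mult_mat_vec[OF L(1) J u(1)] Ju by simp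
  moreover have "R11 *\<^sub>v u + R12 *\<^sub>v 0\<^sub>v l = R11 *\<^sub>v u"
    using R11 R12 u(1) by (intro eq_vecI) auto
  ultimately have "(R11 *\<^sub>v u) \<bullet> (R11 *\<^sub>v u) \<le> (sing_val j R_top)\<^sup>2 * (u \<bullet> u)"
    using L(2)[OF c] norm_blocks(2,4)[OF u(1) zl] by simp
  then have "frobenius_sq V * ((R11 *\<^sub>v u) \<bullet> (R11 *\<^sub>v u)) \<le> frobenius_sq V * ((sing_val j R_top)\<^sup>2 * (u \<bullet> u))"
    by (rule mult_left_mono[OF _ frobenius_sq_nonneg])
  with norm_le_frobenius_inverse[OF u(1)]
  have "1 * (u \<bullet> u) \<le> (frobenius_sq V * (sing_val j R_top)\<^sup>2) * (u \<bullet> u)" by (simp add: mult.assoc)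
  moreover have "0 < u \<bullet> u"
    using scalar_prod_self_nonneg[of u] scalar_prod_self_eq_0[OF u(1)] u(2) by fastforce
  ultimately show ?thesis by (simp only: mult_le_cancel_right_pos)
qed

text \<open>In the application \<open>K = k l\<close>, the number of possible column exchanges.\<close>

context
  fixes K \<mu> :: real
  assumes K: "frobenius_sq V * frobenius_sq R22 + frobenius_sq (V * R12) \<le> K"
    and \<mu>: "1 + 2 * K \<le> \<mu>\<^sup>2" "0 \<le> \<mu>"
begin

lemma K_bounds: "frobenius_sq V * frobenius_sq R22 \<le> K" "frobenius_sq (V * R12) \<le> K" "0 \<le> K"
  using K frobenius_sq_nonneg[of "V * R12"] mult_nonneg_nonneg[OF frobenius_sq_nonneg[of V] frobenius_sq_nonneg[of R22]]
  by auto

text \<open>The same equations serve \<open>R_top\<close> and \<open>R\<close>, since \<open>R\<close> adds only \<open>R22\<close>, and by \<open>sing_val_top_ge_inverse\<close>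
  \<open>\<parallel>R22\<parallel>\<^sup>2 \<le> K / \<parallel>V\<parallel>\<^sup>2 \<le> K \<sigma>\<^sub>j(R_top)\<^sup>2\<close>.\<close>

lemma sing_val_top_ge:
  assumes j: "1 \<le> j" "j \<le> k"
  shows "sing_val j R \<le> \<mu> * sing_val j R_top"
proof -
  have j': "j \<le> min (k + s) (k + l)" using j by simp
  define \<sigma> where "\<sigma> = sing_val j R_top"
  have \<sigma>0: "0 \<le> \<sigma>" unfolding \<sigma>_def by (rule sing_val_nonneg[OF R_top_carrier j(1) j'])
  have "frobenius_sq R22 * 1 \<le> frobenius_sq R22 * (frobenius_sq V * \<sigma>\<^sup>2)"
    unfolding \<sigma>_def by (intro mult_left_mono sing_val_top_ge_inverse j frobenius_sq_nonneg)
  also have "\<dots> = (frobenius_sq V * frobenius_sq R22) * \<sigma>\<^sup>2" by simp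
  also have "\<dots> \<le> K * \<sigma>\<^sup>2" by (intro mult_right_mono K_bounds) auto
  finally have R22K: "frobenius_sq R22 \<le> K * \<sigma>\<^sup>2" by simp
  obtain L where L: "L \<in> carrier_mat (j - 1) (k + l)"
    "\<And>x. x \<in> carrier_vec (k + l) \<Longrightarrow> L *\<^sub>v x = 0\<^sub>v (j - 1)
      \<Longrightarrow> (R_top *\<^sub>v x) \<bullet> (R_top *\<^sub>v x) \<le> \<sigma>\<^sup>2 * (x \<bullet> x)"
    using sing_val_small_subspace[OF R_top_carrier j(1) j'] unfolding \<sigma>_def by metis
  have "sing_val j R \<le> \<mu> * \<sigma>"
  proof (rule sing_val_le[OF R_carrier j(1) j' L(1)])
    show "0 \<le> \<mu> * \<sigma>" using \<mu>(2) \<sigma>0 by simp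
    fix x assume x: "x \<in> carrier_vec (k + l)" and Lx: "L *\<^sub>v x = 0\<^sub>v (j - 1)"
    obtain x1 x2 where x12: "x1 \<in> carrier_vec k" "x2 \<in> carrier_vec l" "x = x1 @\<^sub>v x2"
      using split_vec[OF x] .
    have "(R22 *\<^sub>v x2) \<bullet> (R22 *\<^sub>v x2) \<le> frobenius_sq R22 * (x2 \<bullet> x2)"
      by (rule norm_mult_le_frobenius[OF R22 x12(2)])
    also have "\<dots> \<le> (K * \<sigma>\<^sup>2) * (x \<bullet> x)"
      using R22K norm_blocks(4)[OF x12(1,2)] K_bounds(3) scalar_prod_self_nonneg[of x1] scalar_prod_self_nonneg[of x2]
      by (intro mult_mono) (auto simp: x12(3))
    finally have "(R *\<^sub>v x) \<bullet> (R *\<^sub>v x) \<le> \<sigma>\<^sup>2 * (x \<bullet> x) + (K * \<sigma>\<^sup>2) * (x \<bullet> x)"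
      using L(2)[OF x Lx] norm_blocks[OF x12(1,2)] by (simp add: x12(3))
    also have "\<dots> = (1 + K) * (\<sigma>\<^sup>2 * (x \<bullet> x))" by (simp add: algebra_simps)
    also have "\<dots> \<le> \<mu>\<^sup>2 * (\<sigma>\<^sup>2 * (x \<bullet> x))"
      using \<mu>(1) K_bounds(3) scalar_prod_self_nonneg[of x] by (intro mult_right_mono) auto
    finally show "(R *\<^sub>v x) \<bullet> (R *\<^sub>v x) \<le> (\<mu> * \<sigma>)\<^sup>2 * (x \<bullet> x)" by (simp add: power_mult_distrib)
  qed
  then show ?thesis by (simp add: \<sigma>_def)
qed

text \<open>Let \<open>\<tau> = \<sigma>\<^sub>j(R_rest)\<close>.  There are \<open>j\<close> dimensions on which \<open>R22\<close> stretches by at least \<open>\<tau>\<close>;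
  let \<open>B2\<close> parametrize them by \<open>y\<close>.  The vectors \<open>x = (u - W b, b)\<close> with \<open>b = B2 y\<close> and \<open>u\<close> arbitrary
  form a space of dimension \<open>k + j\<close>.  The shift by \<open>W b\<close> decouples the two block rows:
  \<open>R x = (R11 u, R22 b)\<close>.  Here the first part dominates \<open>\<tau> u\<close> up to the factor \<open>\<surd>K\<close>, as
  \<open>\<tau> \<le> \<parallel>R22\<parallel>\<close>, and the second dominates \<open>\<tau> y\<close>.  If \<open>\<tau> > 0\<close>, then \<open>R\<close> stretches by at least \<open>\<tau> / \<mu>\<close> on
  \<open>k + j\<close> dimensions, which \<open>k + j - 1\<close> equations cannot avoid.\<close>

lemma sing_val_rest_le:
  assumes j: "1 \<le> j" "j \<le> min s l"
  shows "sing_val j R_rest \<le> \<mu> * sing_val (k + j) R"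
proof -
  have j': "j \<le> min (k + s) (k + l)" using j by simp
  have kj: "1 \<le> k + j" "k + j \<le> min (k + s) (k + l)" using j by auto
  define \<tau> where "\<tau> = sing_val j R_rest"
  define \<sigma> where "\<sigma> = sing_val (k + j) R"
  have \<tau>0: "0 \<le> \<tau>" unfolding \<tau>_def by (rule sing_val_nonneg[OF R_rest_carrier j(1) j'])
  have \<sigma>0: "0 \<le> \<sigma>" unfolding \<sigma>_def by (rule sing_val_nonneg[OF R_carrier kj])
  have "\<tau> \<le> \<mu> * \<sigma>"
  proof (cases "\<tau> = 0")
    case True
    then show ?thesis using \<sigma>0 \<mu>(2) by simp
  next
    case False
    then have \<tau>2: "0 < \<tau>\<^sup>2" by simp
    obtain B where B: "B \<in> carrier_mat (k + l) j" "B\<^sup>T * B = 1\<^sub>m j"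
      and EB: "\<And>y. y \<in> carrier_vec j \<Longrightarrow> \<tau>\<^sup>2 * (y \<bullet> y) \<le> (R_rest *\<^sub>v (B *\<^sub>v y)) \<bullet> (R_rest *\<^sub>v (B *\<^sub>v y))"
      using sing_val_large_subspace[OF R_rest_carrier j(1) j'] unfolding \<tau>_def by metis
    \<comment> \<open>\<open>B2\<close> consists of the rows of \<open>B\<close> on which \<open>R22\<close> acts.\<close>
    define B2 where "B2 = mat l j (\<lambda>(a,b). B $$ (k + a, b))"
    have B2: "B2 \<in> carrier_mat l j" by (simp add: B2_def)
    have split: "\<exists>b1\<in>carrier_vec k. B *\<^sub>v y = b1 @\<^sub>v (B2 *\<^sub>v y)" if y: "y \<in> carrier_vec j" for y
    proof (intro bexI)
      show "B *\<^sub>v y = vec_first (B *\<^sub>v y) k @\<^sub>v (B2 *\<^sub>v y)"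
      proof (rule eq_vecI)
        fix i assume "i < dim_vec (vec_first (B *\<^sub>v y) k @\<^sub>v (B2 *\<^sub>v y))"
        then have i: "i < k + l" using B2 by simp
        show "(B *\<^sub>v y) $ i = (vec_first (B *\<^sub>v y) k @\<^sub>v (B2 *\<^sub>v y)) $ i"
        proof (cases "i < k")
          case True
          then show ?thesis using B B2 by (simp add: vec_first_def)
        next
          case False
          then have "row B2 (i - k) = row B i" using i B by (intro eq_vecI) (auto simp: B2_def)
          then show ?thesis using False i B B2 by simp
        qed
      qed (use B B2 in auto)
    qed simp
    have R22B2: "\<tau>\<^sup>2 * (y \<bullet> y) \<le> (R22 *\<^sub>v (B2 *\<^sub>v y)) \<bullet> (R22 *\<^sub>v (B2 *\<^sub>v y))"
      and B2y: "(B2 *\<^sub>v y) \<bullet> (B2 *\<^sub>v y) \<le> y \<bullet> y" if y: "y \<in> carrier_vec j" for y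
    proof -
      obtain b1 where b1: "b1 \<in> carrier_vec k" "B *\<^sub>v y = b1 @\<^sub>v (B2 *\<^sub>v y)" using split[OF y] by blast
      have b2: "B2 *\<^sub>v y \<in> carrier_vec l" using B2 y by simp
      show "\<tau>\<^sup>2 * (y \<bullet> y) \<le> (R22 *\<^sub>v (B2 *\<^sub>v y)) \<bullet> (R22 *\<^sub>v (B2 *\<^sub>v y))"
        using EB[OF y] norm_blocks(3)[OF b1(1) b2] by (simp add: b1(2))
      show "(B2 *\<^sub>v y) \<bullet> (B2 *\<^sub>v y) \<le> y \<bullet> y"
        using norm_blocks(4)[OF b1(1) b2] scalar_prod_isometry[OF B y] scalar_prod_self_nonneg[of b1]
        by (simp add: b1(2))
    qed
    have \<tau>_le: "\<tau>\<^sup>2 \<le> frobenius_sq R22"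
    proof -
      define e where "e = (unit_vec j 0 :: real vec)"
      have e: "e \<in> carrier_vec j" "e \<bullet> e = 1" using j(1) by (auto simp: e_def)
      have "\<tau>\<^sup>2 \<le> (R22 *\<^sub>v (B2 *\<^sub>v e)) \<bullet> (R22 *\<^sub>v (B2 *\<^sub>v e))" using R22B2[OF e(1)] e(2) by simp
      also have "\<dots> \<le> frobenius_sq R22 * ((B2 *\<^sub>v e) \<bullet> (B2 *\<^sub>v e))"
        by (rule norm_mult_le_frobenius[OF R22]) (use B2 e in simp)
      also have "\<dots> \<le> frobenius_sq R22 * 1"
        using B2y[OF e(1)] e(2) by (intro mult_left_mono frobenius_sq_nonneg) simp
      finally show ?thesis by simp
    qed
    define W where "W = V * R12"
    have W: "W \<in> carrier_mat k l" using V R12 by (simp add: W_def)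
    have RW: "R11 * W = R12" using assoc_mult_mat[OF R11 V R12] R12 by (simp add: W_def inverse)
    \<comment> \<open>\<open>T\<close> maps \<open>(u, y)\<close> to \<open>(u - W b, b)\<close>.\<close>
    define T where "T = four_block_mat (1\<^sub>m k) (- (W * B2)) (0\<^sub>m l k) B2"
    have T: "T \<in> carrier_mat (k + l) (k + j)" using B2 by (simp add: T_def)
    have Tz: "T *\<^sub>v (u @\<^sub>v y) = (u - W *\<^sub>v (B2 *\<^sub>v y)) @\<^sub>v (B2 *\<^sub>v y)"
      if uy: "u \<in> carrier_vec k" "y \<in> carrier_vec j" for u y
    proof -
      have "T *\<^sub>v (u @\<^sub>v y) = (1\<^sub>m k *\<^sub>v u + (- (W * B2)) *\<^sub>v y) @\<^sub>v (0\<^sub>m l k *\<^sub>v u + B2 *\<^sub>v y)"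
        unfolding T_def by (rule four_block_mat_mult_vec) (use W B2 uy in auto)
      also have "1\<^sub>m k *\<^sub>v u + (- (W * B2)) *\<^sub>v y = u - W *\<^sub>v (B2 *\<^sub>v y)"
      proof -
        have "(- (W * B2)) *\<^sub>v y = - (W *\<^sub>v (B2 *\<^sub>v y))"
          using uminus_mult_mat_vec[of y "W * B2"] assoc_mult_mat_vec[OF W B2 uy(2)] B2 uy(2) by simp
        moreover have "u + - w = u - w" if "w \<in> carrier_vec k" for w
          using that uy(1) by (intro eq_vecI) auto
        ultimately show ?thesis using W B2 uy by simp
      qed
      also have "0\<^sub>m l k *\<^sub>v u + B2 *\<^sub>v y = B2 *\<^sub>v y"
        using B2 uy by (intro eq_vecI) (auto simp: scalar_prod_def)
      finally show ?thesis .
    qed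
    obtain L where L: "L \<in> carrier_mat (k + j - 1) (k + l)"
      "\<And>x. x \<in> carrier_vec (k + l) \<Longrightarrow> L *\<^sub>v x = 0\<^sub>v (k + j - 1) \<Longrightarrow> (R *\<^sub>v x) \<bullet> (R *\<^sub>v x) \<le> \<sigma>\<^sup>2 * (x \<bullet> x)"
      using sing_val_small_subspace[OF R_carrier kj] unfolding \<sigma>_def by metis
    have LT: "L * T \<in> carrier_mat (k + j - 1) (k + j)" using L(1) T by simp
    have "k + j - 1 < k + j" using j(1) by simp
    obtain z where z: "z \<in> carrier_vec (k + j)" "z \<noteq> 0\<^sub>v (k + j)" "(L * T) *\<^sub>v z = 0\<^sub>v (k + j - 1)"
      using wide_matrix_kernel[OF LT \<open>k + j - 1 < k + j\<close>] by blast
    define u where "u = vec_first z k"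
    define y where "y = vec_last z j"
    have uy: "u \<in> carrier_vec k" "y \<in> carrier_vec j" and z_eq: "z = u @\<^sub>v y"
      using vec_first_last_append[OF z(1)] by (simp_all add: u_def y_def)
    define b where "b = B2 *\<^sub>v y"
    have b: "b \<in> carrier_vec l" using B2 uy by (simp add: b_def)
    have Wb: "W *\<^sub>v b \<in> carrier_vec k" using W b by simp
    define x1 where "x1 = u - W *\<^sub>v b"
    have x1: "x1 \<in> carrier_vec k" using uy Wb by (simp add: x1_def)
    define x where "x = x1 @\<^sub>v b"
    have x: "x \<in> carrier_vec (k + l)" using x1 b by (simp add: x_def)
    have xT: "T *\<^sub>v z = x" using Tz[OF uy] by (simp add: z_eq x_def x1_def b_def)
    have "L *\<^sub>v x = 0\<^sub>v (k + j - 1)" using z(3) assoc_mult_mat_vec[OF L(1) T z(1)] by (simp add: xT)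
    note Rx = L(2)[OF x this]
    have "R11 *\<^sub>v x1 = R11 *\<^sub>v u - R12 *\<^sub>v b"
      using mult_minus_distrib_mat_vec[OF R11 uy(1) Wb] assoc_mult_mat_vec[OF R11 W b]
      by (simp add: x1_def RW)
    then have "R11 *\<^sub>v x1 + R12 *\<^sub>v b = R11 *\<^sub>v u"
      using R11 R12 uy b by (intro eq_vecI) auto
    then have nR: "(R *\<^sub>v x) \<bullet> (R *\<^sub>v x) = (R11 *\<^sub>v u) \<bullet> (R11 *\<^sub>v u) + (R22 *\<^sub>v b) \<bullet> (R22 *\<^sub>v b)"
      using norm_blocks(1)[OF x1 b] by (simp add: x_def)
    have nx: "x \<bullet> x = x1 \<bullet> x1 + b \<bullet> b" using norm_blocks(4)[OF x1 b] by (simp add: x_def)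
    let ?r = "(R11 *\<^sub>v u) \<bullet> (R11 *\<^sub>v u)"
    let ?g = "(R22 *\<^sub>v b) \<bullet> (R22 *\<^sub>v b)"
    have g: "\<tau>\<^sup>2 * (y \<bullet> y) \<le> ?g" using R22B2[OF uy(2)] by (simp add: b_def)
    have by': "b \<bullet> b \<le> y \<bullet> y" using B2y[OF uy(2)] by (simp add: b_def)
    have "(W *\<^sub>v b) \<bullet> (W *\<^sub>v b) \<le> frobenius_sq W * (b \<bullet> b)" by (rule norm_mult_le_frobenius[OF W b])
    also have "\<dots> \<le> K * (y \<bullet> y)"
      using K_bounds(2,3) by' scalar_prod_self_nonneg[of b] by (intro mult_mono) (auto simp: W_def)
    finally have "x \<bullet> x \<le> 2 * (u \<bullet> u) + (1 + 2 * K) * (y \<bullet> y)"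
      using norm_diff_le[OF uy(1) Wb] nx by' by (simp add: x1_def algebra_simps)
    then have "\<tau>\<^sup>2 * (x \<bullet> x) \<le> \<tau>\<^sup>2 * (2 * (u \<bullet> u) + (1 + 2 * K) * (y \<bullet> y))"
      by (intro mult_left_mono) auto
    also have "\<dots> = 2 * (\<tau>\<^sup>2 * (u \<bullet> u)) + (1 + 2 * K) * (\<tau>\<^sup>2 * (y \<bullet> y))" by (simp add: algebra_simps)
    also have "\<dots> \<le> 2 * (K * ?r) + (1 + 2 * K) * ?g"
    proof (intro add_mono mult_left_mono g)
      have "\<tau>\<^sup>2 * (u \<bullet> u) \<le> frobenius_sq R22 * (frobenius_sq V * ?r)"
        by (intro mult_mono \<tau>_le norm_le_frobenius_inverse uy frobenius_sq_nonneg scalar_prod_self_nonneg)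
      also have "\<dots> = (frobenius_sq V * frobenius_sq R22) * ?r" by simp
      also have "\<dots> \<le> K * ?r" by (intro mult_right_mono K_bounds scalar_prod_self_nonneg)
      finally show "\<tau>\<^sup>2 * (u \<bullet> u) \<le> K * ?r" .
    qed (use K_bounds(3) in auto)
    also have "\<dots> \<le> (1 + 2 * K) * ((R *\<^sub>v x) \<bullet> (R *\<^sub>v x))"
      using scalar_prod_self_nonneg[of "R11 *\<^sub>v u"] by (simp add: nR algebra_simps)
    also have "\<dots> \<le> \<mu>\<^sup>2 * (\<sigma>\<^sup>2 * (x \<bullet> x))"
      using \<mu>(1) Rx scalar_prod_self_nonneg[of "R *\<^sub>v x"] by (intro mult_mono) auto
    finally have "\<tau>\<^sup>2 * (x \<bullet> x) \<le> (\<mu> * \<sigma>)\<^sup>2 * (x \<bullet> x)" by (simp add: power_mult_distrib)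
    moreover have "0 < x \<bullet> x"
    proof (rule ccontr)
      assume "\<not> 0 < x \<bullet> x"
      then have "x1 \<bullet> x1 = 0" "b \<bullet> b = 0"
        using nx scalar_prod_self_nonneg[of x1] scalar_prod_self_nonneg[of b] by auto
      then have z0: "x1 = 0\<^sub>v k" "b = 0\<^sub>v l" using scalar_prod_self_eq_0 x1 b by auto
      have "W *\<^sub>v b = 0\<^sub>v k" using W by (intro eq_vecI) (auto simp: z0 scalar_prod_def)
      then have "u = 0\<^sub>v k" using z0(1) uy(1) by (simp add: x1_def)
      have "R22 *\<^sub>v b = 0\<^sub>v s" using R22 by (intro eq_vecI) (auto simp: z0 scalar_prod_def)
      then have "\<tau>\<^sup>2 * (y \<bullet> y) \<le> 0" using g by simp
      then have "y \<bullet> y = 0"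
        using \<tau>2 scalar_prod_self_nonneg[of y] by (metis antisym mult_le_0_iff not_le)
      then have "y = 0\<^sub>v j" using scalar_prod_self_eq_0 uy by auto
      with \<open>u = 0\<^sub>v k\<close> have "z = 0\<^sub>v (k + j)" using append_vec_eq_zero[OF uy] by (simp add: z_eq)
      with z(2) show False by simp
    qed
    ultimately have "\<tau>\<^sup>2 \<le> (\<mu> * \<sigma>)\<^sup>2" by (simp only: mult_le_cancel_right_pos)
    then show ?thesis by (rule power2_le_imp_le[OF _ mult_nonneg_nonneg[OF \<mu>(2) \<sigma>0]])
  qed
  then show ?thesis by (simp add: \<tau>_def \<sigma>_def)
qed

end
end

section \<open>Matrix identities for the factorization\<close>

text \<open>The column space of \<open>A X\<close> lies in that of \<open>A\<close>.\<close>

lemma rank_mult_le: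
  assumes A: "(A :: real mat) \<in> carrier_mat m k" and X: "X \<in> carrier_mat k n"
  shows "vec_space.rank m (A * X) \<le> k"
proof -
  interpret vec_space "TYPE(real)" m .
  have AX: "A * X \<in> carrier_mat m n" using A X by simp
  have A_cols: "set (cols A) \<subseteq> carrier_vec m" and AX_cols: "set (cols (A * X)) \<subseteq> carrier_vec m"
    using A AX cols_dim carrier_matD(1) by blast+
  have "set (cols (A * X)) \<subseteq> span (set (cols A))"
  proof
    fix v assume "v \<in> set (cols (A * X))"
    then obtain j where j: "j < n" "v = col (A * X) j" using AX by (auto simp: cols_def)
    then have v: "v = A *\<^sub>v col X j" using col_mult2[OF A X] by simp
    have "col X j \<in> carrier_vec k" using X j by simp
    then have "v \<in> col_space A" unfolding col_space_eq[OF A] v using A by auto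
    then show "v \<in> span (set (cols A))" by (simp add: col_space_def)
  qed
  then have sub: "span (set (cols (A * X))) \<subseteq> span (set (cols A))"
    by (rule span_subsetI[OF A_cols])
  have subs: "subspace class_ring (span (set (cols A))) V" "subspace class_ring (span (set (cols (A * X)))) V"
    using span_is_subspace A_cols AX_cols by auto
  have nested: "subspace class_ring (span (set (cols (A * X)))) (span_vs (set (cols A)))"
    by (rule nested_subspaces[OF subs sub])
  have "rank (A * X) \<le> rank A"
    unfolding rank_def
    using vectorspace.subspace_dim[OF subspace_is_vs[OF subs(1)] nested fin_dim_span_cols[OF A]]
      fin_dim_span_cols[OF AX] by auto
  also have "\<dots> \<le> k" by (rule rank_le_nc[OF A])
  finally show ?thesis .
qed

lemma mat_inv_eqI:
  assumes A: "A \<in> carrier_mat n n" and B: "B \<in> carrier_mat n n" and AB: "A * B = 1\<^sub>m n"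
  shows "mat_inv A = B"
proof -
  have BA: "B * A = 1\<^sub>m n" by (rule mat_mult_left_right_inverse[OF A B AB])
  have "A \<in> Units (ring_mat TYPE(real) n ())"
    unfolding Units_def ring_mat_simps using A B AB BA by auto
  then obtain C where C: "mat_inverse A = Some C"
    using mat_inverse(1)[OF A, of "()"] by (cases "mat_inverse A") auto
  then have C': "A * C = 1\<^sub>m n" "C \<in> carrier_mat n n" using mat_inverse(2)[OF A] by auto
  have "C = (B * A) * C" using C'(2) by (simp add: BA)
  also have "\<dots> = B * (A * C)" using A B C'(2) by simp
  also have "\<dots> = B" using B by (simp add: C'(1))
  finally show ?thesis by (simp add: mat_inv_def C)
qed

lemma permutation_matrix_carrier: "permutation_matrix n p \<in> carrier_mat n n"
  by (simp add: permutation_matrix_def)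

lemma permutation_matrix_orthogonal:
  assumes p: "p permutes {0..<n}"
  shows "(permutation_matrix n p)\<^sup>T * permutation_matrix n p = 1\<^sub>m n"
proof (rule eq_matI)
  fix i j assume "i < dim_row (1\<^sub>m n :: real mat)" "j < dim_col (1\<^sub>m n :: real mat)"
  then have ij: "i < n" "j < n" by auto
  have pi: "p i < n" using permutes_in_image[OF p, of i] ij by simp
  have inj: "p i = p j \<longleftrightarrow> i = j" using permutes_inj[OF p] by (auto simp: inj_eq)
  have "((permutation_matrix n p)\<^sup>T * permutation_matrix n p) $$ (i,j)
      = (\<Sum>a\<in>{0..<n}. (if a = p i then 1 else 0) * (if a = p j then 1 else 0))"
    using ij by (simp add: permutation_matrix_def scalar_prod_def)
  also have "\<dots> = (\<Sum>a\<in>{0..<n}. if a = p i then (if p i = p j then 1 else 0) else 0)"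
    by (intro sum.cong) auto
  also have "\<dots> = 1\<^sub>m n $$ (i,j)" using ij pi by (simp add: inj)
  finally show "((permutation_matrix n p)\<^sup>T * permutation_matrix n p) $$ (i,j) = 1\<^sub>m n $$ (i,j)" .
qed (auto simp: permutation_matrix_def)

lemma col_mult_permutation_matrix:
  assumes A: "A \<in> carrier_mat m n" and p: "p permutes {0..<n}" and j: "j < n"
  shows "col (A * permutation_matrix n p) j = col A (p j)"
proof (rule eq_vecI)
  fix i assume "i < dim_vec (col A (p j))"
  then have i: "i < m" using A by simp
  have pj: "p j < n" using permutes_in_image[OF p, of j] j by simp
  have "col (A * permutation_matrix n p) j $ i = (\<Sum>a\<in>{0..<n}. A $$ (i, a) * (if a = p j then 1 else 0))"
    using i j A by (simp add: permutation_matrix_def scalar_prod_def)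
  also have "\<dots> = (\<Sum>a\<in>{0..<n}. if a = p j then A $$ (i, p j) else 0)" by (intro sum.cong) auto
  also have "\<dots> = col A (p j) $ i" using pj A i by simp
  finally show "col (A * permutation_matrix n p) j $ i = col A (p j) $ i" .
qed (use A in \<open>auto simp: permutation_matrix_def\<close>)

lemma block_row_carrier:
  assumes "A \<in> carrier_mat m k" "B \<in> carrier_mat m l"
  shows "block_row A B \<in> carrier_mat m (k + l)"
  using assms by (intro carrier_matI) (auto simp: block_row_def)

lemma mult_block_row:
  assumes A: "A \<in> carrier_mat m r" and B: "B \<in> carrier_mat r k" and C: "C \<in> carrier_mat r l"
  shows "A * block_row B C = block_row (A * B) (A * C)"
proof (rule eq_matI)
  note BC = block_row_carrier[OF B C]
  have ABC: "block_row (A * B) (A * C) \<in> carrier_mat m (k + l)" using A B C by (intro block_row_carrier) auto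
  show "dim_row (A * block_row B C) = dim_row (block_row (A * B) (A * C))"
    "dim_col (A * block_row B C) = dim_col (block_row (A * B) (A * C))"
    using A BC ABC by auto
  fix i j assume "i < dim_row (block_row (A * B) (A * C))" "j < dim_col (block_row (A * B) (A * C))"
  then have ij: "i < m" "j < k + l" using ABC by auto
  have "col (block_row B C) j = (if j < k then col B j else col C (j - k))"
    using ij B C by (intro eq_vecI) (auto simp: block_row_def)
  then show "(A * block_row B C) $$ (i,j) = block_row (A * B) (A * C) $$ (i,j)"
    using ij A B C BC by (auto simp: block_row_def)
qed

lemma block_row_mult_upper_blocks:
  assumes Q1: "Q1 \<in> carrier_mat m k" and Q2: "Q2 \<in> carrier_mat m s"
    and R11: "R11 \<in> carrier_mat k k" and R12: "R12 \<in> carrier_mat k l"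
  shows "block_row Q1 Q2 * four_block_mat R11 R12 (0\<^sub>m s k) (0\<^sub>m s l) = Q1 * block_row R11 R12"
proof -
  have "block_row Q1 Q2 * four_block_mat R11 R12 (0\<^sub>m s k) (0\<^sub>m s l)
      = four_block_mat (Q1 * R11 + Q2 * 0\<^sub>m s k) (Q1 * R12 + Q2 * 0\<^sub>m s l)
          (0\<^sub>m 0 k * R11 + 0\<^sub>m 0 s * 0\<^sub>m s k) (0\<^sub>m 0 k * R12 + 0\<^sub>m 0 s * 0\<^sub>m s l)"
    unfolding block_row_def using Q1 Q2
    by (subst mult_four_block_mat[of _ m k _ s _ 0 _ _ k _ l]) (use R11 R12 in auto)
  also have "\<dots> = block_row (Q1 * R11) (Q1 * R12)"
    unfolding block_row_def using assms by (intro cong_four_block_mat) auto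
  also have "\<dots> = Q1 * block_row R11 R12" using mult_block_row[OF Q1 R11 R12] by simp
  finally show ?thesis .
qed

section \<open>Consequences of local maximality\<close>

text \<open>The squared Frobenius norm of \<open>B\<close> is summed by columns and that of \<open>V\<close> by rows, so their product is
  the sum of the cross terms.\<close>

lemma frobenius_sum_bound:
  assumes V: "V \<in> carrier_mat k k" and B: "B \<in> carrier_mat s l" and W: "W \<in> carrier_mat k l"
    and le: "\<And>i j. i < k \<Longrightarrow> j < l \<Longrightarrow> (W $$ (i,j))\<^sup>2 + (col B j \<bullet> col B j) * (row V i \<bullet> row V i) \<le> 1"
  shows "frobenius_sq V * frobenius_sq B + frobenius_sq W \<le> real k * real l"
proof -
  have "frobenius_sq B = (\<Sum>i<s. \<Sum>j<l. (B $$ (i,j))\<^sup>2)"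
    using B by (simp add: frobenius_sq_def scalar_prod_def power2_eq_square atLeast0LessThan)
  also have "\<dots> = (\<Sum>j<l. \<Sum>i<s. (B $$ (i,j))\<^sup>2)" by (rule sum.swap)
  also have "\<dots> = (\<Sum>j<l. col B j \<bullet> col B j)"
    using B by (simp add: scalar_prod_def power2_eq_square atLeast0LessThan)
  finally have fB: "frobenius_sq B = (\<Sum>j<l. col B j \<bullet> col B j)" .
  have fW: "frobenius_sq W = (\<Sum>i<k. \<Sum>j<l. (W $$ (i,j))\<^sup>2)"
    using W by (simp add: frobenius_sq_def scalar_prod_def power2_eq_square atLeast0LessThan)
  have fV: "frobenius_sq V = (\<Sum>i<k. row V i \<bullet> row V i)"
    using V by (simp add: frobenius_sq_def)
  have "frobenius_sq V * frobenius_sq B + frobenius_sq W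
      = (\<Sum>i<k. \<Sum>j<l. (W $$ (i,j))\<^sup>2 + (col B j \<bullet> col B j) * (row V i \<bullet> row V i))"
    unfolding fB fV fW sum_product sum.distrib[symmetric]
    by (intro sum.cong refl) (simp add: mult.commute add.commute)
  also have "\<dots> \<le> (\<Sum>i<k. \<Sum>j<l. 1)" by (intro sum_mono le) auto
  finally show ?thesis by simp
qed

text \<open>A square root of a number that is at least 1 is bounded by that number, here \<open>1 + 5 k n\<close>.\<close>

lemma sqrt_rank_revealing_factor:
  "rank_revealing_factor (\<lambda>m n k. sqrt (1 + 5 * real k * real n))"
  unfolding rank_revealing_factor_def
proof (intro conjI allI impI)
  show "1 \<le> sqrt (1 + 5 * real k * real n)" for m n k :: nat by simp
  define c :: "nat \<Rightarrow> nat \<Rightarrow> nat \<Rightarrow> real"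
    where "c a b e = (if a = 0 \<and> b = 0 \<and> e = 0 then 1 else if a = 0 \<and> b = 1 \<and> e = 1 then 5 else 0)" for a b e
  have "sqrt (1 + 5 * real k * real n)
      \<le> (\<Sum>a\<le>1. \<Sum>b\<le>1. \<Sum>e\<le>1. c a b e * real m ^ a * real n ^ b * real k ^ e)" for m n k :: nat
  proof -
    have "1 + 5 * real k * real n \<le> (1 + 5 * real k * real n)\<^sup>2" by (simp add: power2_eq_square algebra_simps)
    then have "sqrt (1 + 5 * real k * real n) \<le> 1 + 5 * real k * real n" by (simp add: real_le_lsqrt)
    then show ?thesis by (simp add: c_def atMost_Suc algebra_simps)
  qed
  then show "\<exists>d c. \<forall>m n k. 1 \<le> k \<and> k \<le> min m n \<longrightarrow>
      sqrt (1 + 5 * real k * real n) \<le> (\<Sum>a\<le>d. \<Sum>b\<le>d. \<Sum>e\<le>d. c a b e * real m ^ a * real n ^ b * real k ^ e)"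
    by blast
qed

text \<open>Only column exchanges are competitors here, all rows being in use; \<open>g\<close> redirects the \<open>i\<close>-th selected
  column to the new one.\<close>

lemma local_max_volume_swap:
  assumes A: "A \<in> carrier_mat m n" and p: "p permutes {0..<n}" and kmn: "k \<le> m" "k \<le> n"
    and lmv: "local_max_volume A {0..<m} (p ` {0..<k})"
    and i: "i < k" and j: "k \<le> j" "j < n"
  defines "g \<equiv> \<lambda>a. if a = i then j else a"
  shows "det (mat k k (\<lambda>(a,b). col A (p (g a)) \<bullet> col A (p (g b))))
    \<le> det (mat k k (\<lambda>(a,b). col A (p a) \<bullet> col A (p b)))"
proof -
  have inj_p: "inj p" using permutes_inj[OF p] .
  have p_less: "p a < n" if "a < n" for a using permutes_in_image[OF p, of a] that by simp
  have inj1: "inj_on p {0..<k}" using inj_p by (rule inj_on_subset) simp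
  have "inj_on g {0..<k}" using i j by (auto simp: g_def inj_on_def)
  then have inj2: "inj_on (p \<circ> g) {0..<k}" by (rule comp_inj_on) (rule inj_on_subset[OF inj_p], simp)
  have ran1: "p ` {0..<k} \<subseteq> {0..<n}" using kmn p_less by auto
  have ran2: "(p \<circ> g) ` {0..<k} \<subseteq> {0..<n}" using kmn p_less i j by (auto simp: g_def)
  have "p ` {0..<k} - (p \<circ> g) ` {0..<k} \<subseteq> {p i}"
  proof
    fix x assume "x \<in> p ` {0..<k} - (p \<circ> g) ` {0..<k}"
    then obtain a where a: "a < k" "x = p a" "x \<notin> (p \<circ> g) ` {0..<k}" by auto
    have "a = i"
    proof (rule ccontr)
      assume "a \<noteq> i"
      then have "x = (p \<circ> g) a" using a by (simp add: g_def)
      then have "x \<in> (p \<circ> g) ` {0..<k}" using a(1) by (intro image_eqI) auto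
      with a(3) show False by contradiction
    qed
    with a show "x \<in> {p i}" by simp
  qed
  then have "card (p ` {0..<k} - (p \<circ> g) ` {0..<k}) \<le> 1"
    using card_mono[of "{p i}"] by fastforce
  moreover have "card ((p \<circ> g) ` {0..<k}) = card (p ` {0..<k})"
    by (simp only: card_image[OF inj1] card_image[OF inj2])
  ultimately have "volume (submatrix A {0..<m} ((p \<circ> g) ` {0..<k})) \<le> volume (submatrix A {0..<m} (p ` {0..<k}))"
    using lmv A ran2 unfolding local_max_volume_def by auto
  then show ?thesis
    unfolding volume_column_selection[OF A kmn(1) inj1 ran1] volume_column_selection[OF A kmn(1) inj2 ran2]
    by simp
qed

lemma local_max_volume_det_pos:
  assumes A: "A \<in> carrier_mat m n" and p: "p permutes {0..<n}" and kmn: "k \<le> m" "k \<le> n"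
    and lmv: "local_max_volume A {0..<m} (p ` {0..<k})"
  shows "0 < det (mat k k (\<lambda>(a,b). col A (p a) \<bullet> col A (p b)))"
proof -
  have inj1: "inj_on p {0..<k}" using permutes_inj[OF p] by (rule inj_on_subset) simp
  have "p a < n" if "a < n" for a using permutes_in_image[OF p, of a] that by simp
  then have ran1: "p ` {0..<k} \<subseteq> {0..<n}" using kmn by auto
  show ?thesis
    using lmv volume_column_selection[OF A kmn(1) inj1 ran1] by (simp add: local_max_volume_def)
qed

lemma isometry_inner_cols:
  assumes Q: "Q \<in> carrier_mat m r" "Q\<^sup>T * Q = 1\<^sub>m r" and R: "R \<in> carrier_mat r n" and ab: "a < n" "b < n"
  shows "col (Q * R) a \<bullet> col (Q * R) b = col R a \<bullet> (col R b :: real vec)"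
proof -
  have c: "col R a \<in> carrier_vec r" "col R b \<in> carrier_vec r" using R ab by auto
  have "(Q *\<^sub>v col R a) \<bullet> (Q *\<^sub>v col R b) = col R a \<bullet> ((Q\<^sup>T * Q) *\<^sub>v col R b)"
    by (rule scalar_prod_mult_mat_vec2[OF Q(1) c])
  then show ?thesis
    using c(2) by (simp only: col_mult2[OF Q(1) R ab(1)] col_mult2[OF Q(1) R ab(2)] Q(2) one_mult_mat_vec)
qed

text \<open>Inner products of columns of \<open>A P\<close> are those of the columns of \<open>R\<close>, so the Gram determinants before and
  after an exchange are \<open>(det R11)\<^sup>2\<close> and the one computed in \<open>det_gram_exchange_column\<close>.\<close>

lemma local_max_volume_qr:
  assumes A: "A \<in> carrier_mat m (k + l)" and p: "p permutes {0..<k + l}" and km: "k \<le> m"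
    and lmv: "local_max_volume A {0..<m} (p ` {0..<k})"
    and Q: "Q \<in> carrier_mat m (k + s)" "Q\<^sup>T * Q = 1\<^sub>m (k + s)"
    and R11: "R11 \<in> carrier_mat k k" and R12: "R12 \<in> carrier_mat k l" and R22: "R22 \<in> carrier_mat s l"
    and qr: "A * permutation_matrix (k + l) p = Q * four_block_mat R11 R12 (0\<^sub>m s k) R22"
  obtains V where "V \<in> carrier_mat k k" "R11 * V = 1\<^sub>m k"
    "\<And>i j. i < k \<Longrightarrow> j < l \<Longrightarrow> ((V * R12) $$ (i,j))\<^sup>2 + (col R22 j \<bullet> col R22 j) * (row V i \<bullet> row V i) \<le> 1"
proof -
  define R where "R = four_block_mat R11 R12 (0\<^sub>m s k) R22"
  have R: "R \<in> carrier_mat (k + s) (k + l)" using R11 R22 by (simp add: R_def)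
  have colR1: "col R a = col R11 a @\<^sub>v 0\<^sub>v s" if "a < k" for a
    using that R11 R12 R22 by (intro eq_vecI) (auto simp: R_def)
  have colR2: "col R (k + j) = col R12 j @\<^sub>v col R22 j" if "j < l" for j
    using that R11 R12 R22 by (intro eq_vecI) (auto simp: R_def)
  have inner: "col A (p a) \<bullet> col A (p b) = col R a \<bullet> col R b" if "a < k + l" "b < k + l" for a b
    using isometry_inner_cols[OF Q R that] col_mult_permutation_matrix[OF A p] that qr by (simp add: R_def)
  have inner11: "col R a \<bullet> col R b = col R11 a \<bullet> col R11 b" if "a < k" "b < k" for a b
    unfolding colR1[OF that(1)] colR1[OF that(2)]
    by (subst scalar_prod_append[of _ k _ s]) (use R11 that in auto)
  have "mat k k (\<lambda>(a,b). col A (p a) \<bullet> col A (p b)) = R11\<^sup>T * R11"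
    using R11 by (intro eq_matI) (auto simp: inner inner11)
  then have G: "det (mat k k (\<lambda>(a,b). col A (p a) \<bullet> col A (p b))) = (det R11)\<^sup>2"
    using det_mult[of "R11\<^sup>T" k R11] det_transpose[OF R11] R11 by (simp add: power2_eq_square)
  \<comment> \<open>A volume of 0 is excluded in a local maximum, which is what makes \<open>R11\<close> invertible.\<close>
  have pos: "0 < (det R11)\<^sup>2"
    using local_max_volume_det_pos[OF A p km _ lmv] G by simp
  define V where "V = (1 / det R11) \<cdot>\<^sub>m adj_mat R11"
  have V: "V \<in> carrier_mat k k" using adj_mat(1)[OF R11] by (simp add: V_def)
  have "R11 * V = (1 / det R11) \<cdot>\<^sub>m (R11 * adj_mat R11)"
    unfolding V_def by (rule mult_smult_distrib[OF R11 adj_mat(1)[OF R11]])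
  then have RV: "R11 * V = 1\<^sub>m k"
    using pos adj_mat(2)[OF R11] by (intro eq_matI) auto
  show ?thesis
  proof (rule that[OF V RV])
    fix i j assume ij: "i < k" "j < l"
    define v where "v = col R12 j"
    define w where "w = col R22 j"
    have v: "v \<in> carrier_vec k" and w: "w \<in> carrier_vec s" using R12 R22 ij by (auto simp: v_def w_def)
    define g where "g a = (if a = i then k + j else a)" for a
    have colg: "col R (g a) = (if a = i then v else col R11 a) @\<^sub>v (if a = i then w else 0\<^sub>v s)" if "a < k" for a
      using that ij colR1[of a] colR2[of j] by (simp add: g_def v_def w_def)
    have g_less: "g a < k + l" if "a < k" for a using that ij by (simp add: g_def)
    have innerg: "col R (g a) \<bullet> col R (g b) = (if a = i then v else col R11 a) \<bullet> (if b = i then v else col R11 b)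
        + (if a = i \<and> b = i then w \<bullet> w else 0)" if "a < k" "b < k" for a b
      unfolding colg[OF that(1)] colg[OF that(2)]
      by (subst scalar_prod_append[of _ k _ s]) (use R11 v w that in auto)
    have "mat k k (\<lambda>(a,b). col A (p (g a)) \<bullet> col A (p (g b)))
        = mat k k (\<lambda>(a,b). (if a = i then v else col R11 a) \<bullet> (if b = i then v else col R11 b)
            + (if a = i \<and> b = i then w \<bullet> w else 0))"
      by (rule eq_matI) (simp_all only: index_mat dim_row_mat dim_col_mat split inner g_less innerg)
    then have "(det R11)\<^sup>2 * (((V *\<^sub>v v) $ i)\<^sup>2 + (w \<bullet> w) * (row V i \<bullet> row V i)) \<le> (det R11)\<^sup>2 * 1"
      using local_max_volume_swap[OF A p km _ lmv ij(1), of "k + j"] ij(2) G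
        det_gram_exchange_column[OF R11 V RV v ij(1), of "w \<bullet> w"] by (simp add: g_def)
    then have "((V *\<^sub>v v) $ i)\<^sup>2 + (w \<bullet> w) * (row V i \<bullet> row V i) \<le> 1"
      using pos by (simp only: mult_le_cancel_left_pos)
    moreover have "(V * R12) $$ (i,j) = (V *\<^sub>v v) $ i" using ij V R12 by (simp add: v_def)
    ultimately show "((V * R12) $$ (i,j))\<^sup>2 + (col R22 j \<bullet> col R22 j) * (row V i \<bullet> row V i) \<le> 1"
      by (simp add: w_def)
  qed
qed

text \<open>Since \<open>A P = Q R\<close>, \<open>A\<^sub>k P = Q R_top\<close> and \<open>(A - A\<^sub>k) P = Q R_rest\<close>, the estimates for the blocks of \<open>R\<close>
  carry over unchanged.\<close>

lemma qr_local_max_volume_rank_reveals: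
  fixes m n k :: nat
  defines "\<mu> \<equiv> sqrt (1 + 5 * real k * real n)"
  assumes k: "k \<le> min m n" and A: "A \<in> carrier_mat m n" and p: "p permutes {0..<n}"
    and P_def: "P = permutation_matrix n p"
    and lmv: "local_max_volume A {0..<m} (p ` {0..<k})"
    and qr: "partial_qr m n k (A * P) Q1 Q2 R11 R12 R22"
    and Ak_def: "Ak = Q1 * block_row R11 R12 * mat_inv P"
  shows "rank_reveals m n k \<mu> A Ak \<and> invertible_mat R11 \<and> max_norm (mat_inv R11 * R12) \<le> 1"
proof -
  define l where "l = n - k"
  define s where "s = min m n - k"
  have n: "n = k + l" and ms: "min m n = k + s" and km: "k \<le> m" using k by (auto simp: l_def s_def)
  define Q where "Q = block_row Q1 Q2"
  have Q1: "Q1 \<in> carrier_mat m k" and Q2: "Q2 \<in> carrier_mat m s"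
    and R11: "R11 \<in> carrier_mat k k" and R12: "R12 \<in> carrier_mat k l" and R22: "R22 \<in> carrier_mat s l"
    and QQ: "Q\<^sup>T * Q = 1\<^sub>m (k + s)"
    and AP: "A * P = Q * four_block_mat R11 R12 (0\<^sub>m s k) R22"
    using qr by (simp_all add: partial_qr_def l_def[symmetric] s_def[symmetric] Q_def ms)
  have Q: "Q \<in> carrier_mat m (k + s)" unfolding Q_def by (rule block_row_carrier[OF Q1 Q2])
  have P: "P \<in> carrier_mat n n" "P\<^sup>T * P = 1\<^sub>m n"
    unfolding P_def by (rule permutation_matrix_carrier, rule permutation_matrix_orthogonal[OF p])
  have PP: "P * P\<^sup>T = 1\<^sub>m n" using mat_mult_left_right_inverse[OF _ P] P(1) by simp
  have P_inv: "mat_inv P = P\<^sup>T" by (rule mat_inv_eqI[OF P(1) _ PP]) (use P in simp)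
  obtain V where V: "V \<in> carrier_mat k k" and RV: "R11 * V = 1\<^sub>m k"
    and exch: "\<And>i j. i < k \<Longrightarrow> j < l \<Longrightarrow>
      ((V * R12) $$ (i,j))\<^sup>2 + (col R22 j \<bullet> col R22 j) * (row V i \<bullet> row V i) \<le> 1"
    using local_max_volume_qr[OF A[unfolded n] p[unfolded n] km lmv Q QQ R11 R12 R22] AP
    unfolding P_def n by metis
  have VR: "V * R11 = 1\<^sub>m k" by (rule mat_mult_left_right_inverse[OF R11 V RV])
  have W: "V * R12 \<in> carrier_mat k l" using V R12 by simp
  interpret triangular_blocks k l s R11 R12 R22 V
    by unfold_locales (fact R11 R12 R22 V RV VR)+
  have K: "frobenius_sq V * frobenius_sq R22 + frobenius_sq (V * R12) \<le> real k * real l"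
    by (rule frobenius_sum_bound[OF V R22 W exch])
  have \<mu>0: "0 < \<mu>" unfolding \<mu>_def by (simp add: add_pos_nonneg)
  have "\<mu>\<^sup>2 = 1 + 5 * real k * real n" unfolding \<mu>_def by simp
  moreover have "2 * (real k * real l) \<le> 5 * real k * real n"
  proof -
    have "real k * real l \<le> real k * real n" by (intro mult_left_mono) (auto simp: n)
    moreover have "0 \<le> real k * real n" by simp
    ultimately show ?thesis by linarith
  qed
  ultimately have \<mu>: "1 + 2 * (real k * real l) \<le> \<mu>\<^sup>2" by linarith
  have AP': "A * P = Q * R" using AP by (simp add: R_def)
  have X: "Q1 * block_row R11 R12 \<in> carrier_mat m n"
    using Q1 block_row_carrier[OF R11 R12] by (simp add: n)
  have Ak: "Ak \<in> carrier_mat m n" using X P by (simp add: Ak_def P_inv)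
  have "Ak * P = (Q1 * block_row R11 R12) * (P\<^sup>T * P)"
    unfolding Ak_def P_inv by (rule assoc_mult_mat[OF X _ P(1)]) (use P in simp)
  also have "\<dots> = Q * R_top"
    using right_mult_one_mat[OF X] block_row_mult_upper_blocks[OF Q1 Q2 R11 R12] by (simp add: P(2) Q_def R_top_def)
  finally have AkP: "Ak * P = Q * R_top" .
  have "R - R_top = R_rest"
    by (rule eq_matI) (use R11 R12 R22 in \<open>auto simp: R_def R_top_def R_rest_def\<close>)
  then have AAkP: "(A - Ak) * P = Q * R_rest"
    using minus_mult_distrib_mat[OF A Ak P(1)] mult_minus_distrib_mat[OF Q R_carrier R_top_carrier]
    by (simp add: AP' AkP)
  have mk: "min m (k + l) = min (k + s) (k + l)" using ms n by simp
  have svA: "sing_val j A = sing_val j R" for j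
    using singular_values_mult_orthogonal[OF A P] singular_values_isometry[OF Q QQ R_carrier mk]
    by (simp add: sing_val_def AP')
  have svAk: "sing_val j Ak = sing_val j R_top" for j
    using singular_values_mult_orthogonal[OF Ak P] singular_values_isometry[OF Q QQ R_top_carrier mk]
    by (simp add: sing_val_def AkP)
  have svE: "sing_val j (A - Ak) = sing_val j R_rest" for j
    using singular_values_mult_orthogonal[OF minus_carrier_mat[OF Ak] P, of A] singular_values_isometry[OF Q QQ R_rest_carrier mk]
    by (simp add: sing_val_def AAkP)
  have \<mu>1: "1 \<le> \<mu>" unfolding \<mu>_def by simp
  have up: "x \<le> y \<Longrightarrow> x \<le> \<mu> * y" if "0 \<le> y" for x y :: real
    using mult_right_mono[OF \<mu>1 that] by simp
  have down: "1 / \<mu> * x \<le> y" if "x \<le> \<mu> * y" for x y :: real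
    using that \<mu>0 by (simp add: field_simps)
  have "vec_space.rank m Ak \<le> k"
  proof -
    have "Ak = Q1 * (block_row R11 R12 * P\<^sup>T)"
      unfolding Ak_def P_inv
      by (rule assoc_mult_mat[OF Q1 block_row_carrier[OF R11 R12]]) (use P n in auto)
    moreover have "block_row R11 R12 * P\<^sup>T \<in> carrier_mat k n"
      using block_row_carrier[OF R11 R12] P n by simp
    ultimately show ?thesis using rank_mult_le[OF Q1] by simp
  qed
  moreover have "1 / \<mu> * sing_val j A \<le> sing_val j Ak \<and> sing_val j Ak \<le> \<mu> * sing_val j A" if "j \<in> {1..k}" for j
  proof
    have j: "1 \<le> j" "j \<le> k" using that by auto
    then have j': "j \<le> min (k + s) (k + l)" by simp
    show "1 / \<mu> * sing_val j A \<le> sing_val j Ak"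
      using down[OF sing_val_top_ge[OF K \<mu> less_imp_le[OF \<mu>0] j]] by (simp add: svA svAk)
    show "sing_val j Ak \<le> \<mu> * sing_val j A"
      using up[OF sing_val_nonneg[OF R_carrier j(1) j'] sing_val_top_le[OF j(1) j']] by (simp add: svA svAk)
  qed
  moreover have "1 / \<mu> * sing_val (k + j) A \<le> sing_val j (A - Ak) \<and> sing_val j (A - Ak) \<le> \<mu> * sing_val (k + j) A"
    if "j \<in> {1..min m n - k}" for j
  proof
    have j: "1 \<le> j" "j \<le> min s l" using that by (auto simp: s_def l_def)
    then have j': "j \<le> min (k + s) (k + l)" by simp
    show "1 / \<mu> * sing_val (k + j) A \<le> sing_val j (A - Ak)"
      using down[OF up[OF sing_val_nonneg[OF R_rest_carrier j(1) j'] sing_val_rest_ge[OF j]]] by (simp add: svA svE)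
    show "sing_val j (A - Ak) \<le> \<mu> * sing_val (k + j) A"
      using sing_val_rest_le[OF K \<mu> less_imp_le[OF \<mu>0] j] by (simp add: svA svE)
  qed
  ultimately have 1: "rank_reveals m n k \<mu> A Ak" unfolding rank_reveals_def by blast
  have 2: "invertible_mat R11"
    unfolding invertible_mat_def inverts_mat_def using R11 V RV VR by auto
  have "\<bar>x\<bar> \<le> 1" if x_in: "x \<in> elements_mat (V * R12)" for x
  proof -
    obtain i j where "i < dim_row (V * R12)" "j < dim_col (V * R12)" and x: "x = (V * R12) $$ (i,j)"
      using elements_matD[OF x_in] by blast
    then have ij: "i < k" "j < l" using carrier_matD[OF W] by simp_all
    have "0 \<le> (col R22 j \<bullet> col R22 j) * (row V i \<bullet> row V i)"
      by (intro mult_nonneg_nonneg scalar_prod_self_nonneg)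
    with exch[OF ij] have "x\<^sup>2 \<le> 1" unfolding x by linarith
    then show ?thesis by (simp add: abs_square_le_1)
  qed
  moreover have "finite (elements_mat (V * R12))"
    unfolding elements_mat_def by (rule finite_set)
  ultimately have 3: "max_norm (V * R12) \<le> 1" by (simp add: max_norm_def)
  have "mat_inv R11 = V" by (rule mat_inv_eqI[OF R11 V RV])
  with 1 2 3 show ?thesis by simp
qed

theorem theorem4p1:
  fixes \<mu> :: "nat \<Rightarrow> nat \<Rightarrow> nat \<Rightarrow> real"
  assumes mu: "\<mu> = (\<lambda>m n k. sqrt (1 + 5 * real k * real n))"
  shows "rank_revealing_factor \<mu> \<and>
    (\<forall>m n k A p P Q1 Q2 R11 R12 R22 Ak.
       1 \<le> m \<and> 1 \<le> n \<and> 1 \<le> k \<and> k \<le> min m n \<and>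
       A \<in> carrier_mat m n \<and>
       p permutes {0..<n} \<and> P = permutation_matrix n p \<and>
       local_max_volume A {0..<m} (p ` {0..<k}) \<and>
       partial_qr m n k (A * P) Q1 Q2 R11 R12 R22 \<and>
       Ak = Q1 * block_row R11 R12 * mat_inv P
       \<longrightarrow>
       rank_reveals m n k (\<mu> m n k) A Ak \<and>
       invertible_mat R11 \<and> max_norm (mat_inv R11 * R12) \<le> 1)"
proof (intro conjI[of "rank_revealing_factor \<mu>"] allI impI)
  show "rank_revealing_factor \<mu>" unfolding mu by (rule sqrt_rank_revealing_factor)
next
  fix m n k A p P Q1 Q2 R11 R12 R22 Ak
  assume a: "1 \<le> m \<and> 1 \<le> n \<and> 1 \<le> k \<and> k \<le> min m n \<and>
       A \<in> carrier_mat m n \<and>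
       p permutes {0..<n} \<and> P = permutation_matrix n p \<and>
       local_max_volume A {0..<m} (p ` {0..<k}) \<and>
       partial_qr m n k (A * P) Q1 Q2 R11 R12 R22 \<and>
       Ak = Q1 * block_row R11 R12 * mat_inv P"
  have "k \<le> min m n" "A \<in> carrier_mat m n" "p permutes {0..<n}" "P = permutation_matrix n p"
    "local_max_volume A {0..<m} (p ` {0..<k})" "partial_qr m n k (A * P) Q1 Q2 R11 R12 R22"
    "Ak = Q1 * block_row R11 R12 * mat_inv P"
    using a by - (elim conjE, assumption)+
  from qr_local_max_volume_rank_reveals[OF this]
  show "rank_reveals m n k (\<mu> m n k) A Ak \<and> invertible_mat R11 \<and> max_norm (mat_inv R11 * R12) \<le> 1"
    unfolding mu .
qed

end
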